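(* Let $N\ge 1$ and let $\mu \vdash N+1$ be a partition of length $p$ with $p \equiv N \pmod 2$. Then $$\frac{N+1}{2} \sum_{\substack{i>0\\ \lambda = \mu^{\downarrow (i+1)}}} i\, m_i(\lambda)\, B(\lambda) \;=\; A(\mu) \;=\; \frac{(N+1)!}{z_\mu},$$ where the sum runs over all $i>0$ such that $\mu$ has at least one part equal to $i+1$.
   Context: For a partition $\lambda \vdash n$, $m_i(\lambda)$ denotes the number of parts of $\lambda$ equal to $i$, and $z_\mu=\prod_i i^{m_i(\mu)} m_i(\mu)!$. The type of a permutation is the partition given by its cycle lengths. $A(\lambda)$ is the number of permutations in $S_n$ of type $\lambda$. For $\lambda \vdash N$, $B(\lambda)$ is the number of permutations $\beta\in S_N$ of type $\lambda$ such that $(1\ 2\ \ldots\ N)\beta^{-1}$ is an $N$-cycle. If $\mu$ has at least one part equal to $i+1$, $\mu^{\downarrow (i+1)}$ is the partition obtained from $\mu$ by removing one part $i+1$ and adding one part $i$ (so it has the same length as $\mu$ and size one less). *)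

theory Defs
  imports Complex_Main "HOL-Library.Multiset" "HOL-Combinatorics.Permutations" "HOL-Combinatorics.Orbits"
begin

definition is_partition :: "nat \<Rightarrow> nat multiset \<Rightarrow> bool" where
  "is_partition n lam \<longleftrightarrow> 0 \<notin># lam \<and> sum_mset lam = n"

definition zee :: "nat multiset \<Rightarrow> nat" where
  "zee mu = (\<Prod>i\<in>set_mset mu. i ^ count mu i * fact (count mu i))"

text \<open>Cycle type of a permutation of \<open>{1..n}\<close> (fixed points give parts equal to 1).\<close>

definition cycle_type :: "nat \<Rightarrow> (nat \<Rightarrow> nat) \<Rightarrow> nat multiset" where
  "cycle_type n \<sigma> = image_mset card (mset_set ((\<lambda>x. orbit \<sigma> x) ` {1..n}))"

definition A_count :: "nat multiset \<Rightarrow> nat" where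
  "A_count lam = card {\<sigma>. \<sigma> permutes {1..sum_mset lam} \<and> cycle_type (sum_mset lam) \<sigma> = lam}"

definition long_cycle :: "nat \<Rightarrow> nat \<Rightarrow> nat" where
  "long_cycle N i = (if 1 \<le> i \<and> i < N then i + 1 else if i = N then 1 else i)"

definition B_count :: "nat multiset \<Rightarrow> nat" where
  "B_count lam = card {\<beta>. \<beta> permutes {1..sum_mset lam} \<and> cycle_type (sum_mset lam) \<beta> = lam
      \<and> cycle_type (sum_mset lam) (long_cycle (sum_mset lam) \<circ> inv \<beta>) = {#sum_mset lam#}}"

definition lower_part :: "nat multiset \<Rightarrow> nat \<Rightarrow> nat multiset" where
  "lower_part mu i = add_mset i (mu - {#i + 1#})"

end

theory Submission
  imports Defs
begin

text \<open>
  Adding the point \<open>N + 1\<close> to a cycle of length \<open>i\<close> of \<open>\<beta>\<close> identifies the sum over \<open>i\<close> with the number of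
  permutations \<open>\<sigma>\<close> of type \<open>\<mu>\<close> that move \<open>N + 1\<close> and for which deleting \<open>N + 1\<close> leaves a \<open>\<beta>\<close> with
  \<open>(1 2 \<dots> N) \<beta>\<inverse>\<close> an \<open>N\<close>-cycle. Averaging over all \<open>N\<close>-cycles and over all choices of the deleted
  point turns this into the number of ways to write the permutations \<open>\<sigma>\<close> of type \<open>\<mu>\<close>, which are odd, as a
  product of an \<open>(N + 1)\<close>-cycle and an \<open>N\<close>-cycle. Every odd permutation of \<open>n\<close> points has exactly
  \<open>2 (n - 2)!\<close> such factorizations: deleting a point moved by \<open>\<sigma>\<close> from both factors leads to \<open>n - 2\<close> odd
  permutations of \<open>n - 1\<close> points, and the factorizations that cannot be reached in this way are in bijection
  with those that have to be excluded.
\<close>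

section \<open>Cyclic permutations and the deletion of a point\<close>

text \<open>The orbit of a point is the smallest closed set containing it. This form replaces orbit
  inductions by comparisons of closed sets when a point is inserted into a cycle.\<close>

lemma cyclic_on_iff_minimal:
  "cyclic_on c X \<longleftrightarrow> X \<noteq> {} \<and> c ` X \<subseteq> X \<and> (\<forall>S. S \<subseteq> X \<and> S \<noteq> {} \<and> c ` S \<subseteq> S \<longrightarrow> S = X)"
proof
  assume "cyclic_on c X"
  then have X: "X \<noteq> {}" "\<And>s. s \<in> X \<Longrightarrow> X = orbit c s"
    by (auto simp: cyclic_on_alldef)
  have "c ` X \<subseteq> X"
    using X by (metis image_subsetI orbit.base)
  moreover have "S = X" if S: "S \<subseteq> X" "S \<noteq> {}" "c ` S \<subseteq> S" for S
  proof -
    obtain s where s: "s \<in> S" using S by auto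
    have "x \<in> S" if "x \<in> orbit c s" for x
      using that by induction (use s S in auto)
    then show ?thesis
      using X(2)[of s] s S by auto
  qed
  ultimately show "X \<noteq> {} \<and> c ` X \<subseteq> X \<and> (\<forall>S. S \<subseteq> X \<and> S \<noteq> {} \<and> c ` S \<subseteq> S \<longrightarrow> S = X)"
    using X by blast
next
  assume R: "X \<noteq> {} \<and> c ` X \<subseteq> X \<and> (\<forall>S. S \<subseteq> X \<and> S \<noteq> {} \<and> c ` S \<subseteq> S \<longrightarrow> S = X)"
  then obtain s where s: "s \<in> X" by auto
  have "x \<in> X" if "x \<in> orbit c s" for x
    using that by induction (use s R in auto)
  moreover have "c ` orbit c s \<subseteq> orbit c s"
    by (auto intro: orbit.step)
  moreover have "orbit c s \<noteq> {}"
    by (rule orbit_nonempty)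
  ultimately have "orbit c s = X"
    using R by (metis subsetI)
  then show "cyclic_on c X"
    using s by (auto simp: cyclic_on_def)
qed

text \<open>Composing with \<open>transpose a u\<close> makes \<open>u\<close> map to
  \<open>a\<close> and \<open>a\<close> to the old image of \<open>u\<close>, so \<open>a\<close> is
  inserted into the cycle right after \<open>u\<close>. A closed set of one map becomes a closed set
  of the other by adding \<open>a\<close> if it contains \<open>u\<close>, respectively by removing
  \<open>a\<close>.\<close>

lemma cyclic_on_insert_iff:
  assumes a: "a \<notin> Y" "c a = a" and u: "u \<in> Y" and Y: "c ` Y \<subseteq> Y"
  shows "cyclic_on (c \<circ> transpose a u) (insert a Y) \<longleftrightarrow> cyclic_on c Y"
proof -
  let ?d = "c \<circ> transpose a u"
  have du: "?d u = a" and da: "?d a = c u" using a u by auto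
  have dx: "?d x = c x" if "x \<noteq> a" "x \<noteq> u" for x using that by simp
  have img: "?d ` insert a Y \<subseteq> insert a Y"
  proof (rule image_subsetI)
    fix x assume "x \<in> insert a Y"
    then show "?d x \<in> insert a Y"
      using Y u du da dx[of x] by (cases "x = a"; cases "x = u") auto
  qed
  show ?thesis
  proof
    assume L: "cyclic_on ?d (insert a Y)"
    have "S = Y" if S: "S \<subseteq> Y" "S \<noteq> {}" "c ` S \<subseteq> S" for S
    proof -
      let ?T = "S \<union> (if u \<in> S then {a} else {})"
      have "?d ` ?T \<subseteq> ?T"
      proof (rule image_subsetI)
        fix x assume x: "x \<in> ?T"
        show "?d x \<in> ?T"
        proof (cases "x = a \<or> x = u")
          case True
          then show ?thesis using x S a du da by (auto split: if_splits)
        next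
          case False
          then have "x \<in> S" using x by (auto split: if_splits)
          then show ?thesis using False S dx[of x] by auto
        qed
      qed
      moreover have "?T \<subseteq> insert a Y" "?T \<noteq> {}" using S by auto
      ultimately have "?T = insert a Y"
        using L unfolding cyclic_on_iff_minimal by blast
      then show ?thesis using S a by (auto split: if_splits)
    qed
    then show "cyclic_on c Y"
      using u Y unfolding cyclic_on_iff_minimal by blast
  next
    assume R: "cyclic_on c Y"
    have "S = insert a Y" if S: "S \<subseteq> insert a Y" "S \<noteq> {}" "?d ` S \<subseteq> S" for S
    proof -
      have sub: "?d x \<in> S" if "x \<in> S" for x using S that by blast
      have cx: "c x \<in> S - {a}" if "x \<in> S - {a}" for x
      proof (cases "x = u")
        case True
        have "c u \<in> S" using sub[of u] sub[of a] that True du da by auto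
        moreover have "c u \<noteq> a" using Y u a by auto
        ultimately show ?thesis using True by auto
      next
        case False
        moreover have "c x \<noteq> a" using that S Y a by auto
        ultimately show ?thesis using sub[of x] dx[of x] that by auto
      qed
      have ne: "S - {a} \<noteq> {}"
      proof
        assume "S - {a} = {}"
        then have "a \<in> S" "S \<subseteq> {a}" using S by auto
        then have "c u = a" using sub[of a] da by auto
        then show False using Y u a by auto
      qed
      have "S - {a} = Y"
        using R S cx ne unfolding cyclic_on_iff_minimal by (metis Diff_insert0 Diff_subset_conv image_subsetI insert_is_Un)
      then show ?thesis using sub[of u] du u by auto
    qed
    then show "cyclic_on ?d (insert a Y)"
      unfolding cyclic_on_iff_minimal using img by blast
  qed
qed

text \<open>For a permutation \<open>c\<close>, \<open>\<tau>\<close> is \<open>inv c\<close>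
  composed with \<open>c \<circ> \<tau>\<close>, so on a finite \<open>X\<close> this set
  parametrizes the ways to write \<open>\<tau>\<close> as a product of two full cycles.\<close>

definition bicyclic :: "'a set \<Rightarrow> ('a \<Rightarrow> 'a) \<Rightarrow> ('a \<Rightarrow> 'a) set" where
  "bicyclic X \<tau> = {c. c permutes X \<and> cyclic_on c X \<and> cyclic_on (c \<circ> \<tau>) X}"

text \<open>
  If \<open>c\<close> maps \<open>\<tau> v\<close> to \<open>a\<close>, then \<open>c \<circ> \<tau>\<close> maps \<open>v\<close> to \<open>a\<close>. Deleting \<open>a\<close> from the cycles of both \<open>c\<close> and
  \<open>c \<circ> \<tau>\<close> replaces \<open>\<tau>\<close> by \<open>contract a v \<tau>\<close>. For \<open>v = a\<close> this is the deletion of \<open>a\<close> from the cycles of \<open>\<tau>\<close>.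
\<close>

definition contract :: "'a \<Rightarrow> 'a \<Rightarrow> ('a \<Rightarrow> 'a) \<Rightarrow> 'a \<Rightarrow> 'a" where
  "contract a v \<tau> = transpose a (\<tau> v) \<circ> \<tau> \<circ> transpose a v"

lemma contract_fixes [simp]: "contract a v \<tau> a = a"
  by (simp add: contract_def)

lemma contract_self: "contract a a \<tau> = transpose a (\<tau> a) \<circ> \<tau>"
  by (simp add: contract_def fun_eq_iff)

lemma contract_permutes:
  assumes "\<tau> permutes X" "a \<in> X" "v \<in> X"
  shows "contract a v \<tau> permutes (X - {a})"
proof (rule permutes_superset)
  show "contract a v \<tau> permutes X"
    unfolding contract_def
    by (intro permutes_compose permutes_swap_id assms) (use assms in \<open>simp add: permutes_in_image\<close>)
  show "contract a v \<tau> x = x" if "x \<in> X - (X - {a})" for x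
    using that by simp
qed

lemma finite_bicyclic: "finite X \<Longrightarrow> finite (bicyclic X \<tau>)"
  unfolding bicyclic_def by (rule finite_subset[OF _ finite_permutations[of X]]) auto

lemma cyclic_on_moves:
  assumes "cyclic_on c X" "a \<in> X" "X \<noteq> {a}"
  shows "c a \<noteq> a"
  using assms orbit_eq_singleton_iff[of c a] by (auto simp: cyclic_on_alldef)

text \<open>For \<open>c\<close> fixing \<open>a\<close>, right multiplication by
  \<open>transpose a (\<tau> v)\<close> inserts \<open>a\<close> after \<open>\<tau> v\<close> in
  \<open>c\<close> and at the same time after \<open>v\<close> in
  \<open>c \<circ> contract a v \<tau>\<close>. Both cyclicity conditions therefore pass to
  \<open>X - {a}\<close> together.\<close>

lemma card_bicyclic_fibre:
  assumes X: "finite X" and \<tau>: "\<tau> permutes X" and a: "a \<in> X"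
    and v: "v \<in> X - {a}" "\<tau> v \<noteq> a"
  shows "card {c \<in> bicyclic X \<tau>. c (\<tau> v) = a} = card (bicyclic (X - {a}) (contract a v \<tau>))"
proof -
  let ?u = "\<tau> v" and ?Y = "X - {a}"
  let ?t = "transpose a ?u"
  have u: "?u \<in> ?Y" using v \<tau> by (simp add: permutes_in_image)
  have XY: "X = insert a ?Y" using a by auto
  have key: "c \<circ> ?t \<in> bicyclic X \<tau> \<longleftrightarrow> c \<in> bicyclic ?Y (contract a v \<tau>)"
    if c: "c permutes ?Y" for c
  proof -
    have ca: "c a = a" using c by (simp add: permutes_not_in)
    have p: "c \<circ> ?t permutes X"
      by (intro permutes_compose permutes_swap_id permutes_subset[OF c]) (use u a in auto)
    have 1: "cyclic_on (c \<circ> ?t) X \<longleftrightarrow> cyclic_on c ?Y"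
      using cyclic_on_insert_iff[of a ?Y c ?u] u ca permutes_image[OF c] XY by simp
    \<comment> \<open>The \<open>transpose a v\<close> on the right cancels the one inside
      \<open>contract\<close>; in this form the second map is an insertion of \<open>a\<close> after
      \<open>v\<close>.\<close>
    have e: "c \<circ> ?t \<circ> \<tau> = (c \<circ> contract a v \<tau>) \<circ> transpose a v"
      by (simp add: contract_def fun_eq_iff)
    have q: "c \<circ> contract a v \<tau> permutes ?Y"
      by (intro permutes_compose contract_permutes c \<tau> a) (use v in auto)
    have 2: "cyclic_on (c \<circ> ?t \<circ> \<tau>) X \<longleftrightarrow> cyclic_on (c \<circ> contract a v \<tau>) ?Y"
      unfolding e using cyclic_on_insert_iff[of a ?Y "c \<circ> contract a v \<tau>" v] v ca permutes_image[OF q] XY by simp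
    show ?thesis unfolding bicyclic_def using p c 1 2 by simp
  qed
  have "bij_betw (\<lambda>c. c \<circ> ?t) (bicyclic ?Y (contract a v \<tau>)) {c \<in> bicyclic X \<tau>. c ?u = a}"
  proof (rule bij_betw_byWitness[where f' = "\<lambda>c. c \<circ> ?t"])
    show "\<forall>c\<in>bicyclic ?Y (contract a v \<tau>). (c \<circ> ?t) \<circ> ?t = c"
      by (simp add: fun_eq_iff)
    show "\<forall>c\<in>{c \<in> bicyclic X \<tau>. c ?u = a}. (c \<circ> ?t) \<circ> ?t = c"
      by (simp add: fun_eq_iff)
    show "(\<lambda>c. c \<circ> ?t) ` bicyclic ?Y (contract a v \<tau>) \<subseteq> {c \<in> bicyclic X \<tau>. c ?u = a}"
    proof clarify
      fix c assume c: "c \<in> bicyclic ?Y (contract a v \<tau>)"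
      then have "c permutes ?Y" by (simp add: bicyclic_def)
      then show "c \<circ> ?t \<in> bicyclic X \<tau> \<and> (c \<circ> ?t) ?u = a"
        using key c by (simp add: permutes_not_in)
    qed
    show "(\<lambda>c. c \<circ> ?t) ` {c \<in> bicyclic X \<tau>. c ?u = a} \<subseteq> bicyclic ?Y (contract a v \<tau>)"
    proof (rule image_subsetI, elim CollectE conjE)
      fix c assume c: "c \<in> bicyclic X \<tau>" "c ?u = a"
      have "c \<circ> ?t permutes ?Y"
      proof (rule permutes_superset)
        show "c \<circ> ?t permutes X"
          by (intro permutes_compose permutes_swap_id) (use c u a in \<open>auto simp: bicyclic_def\<close>)
      qed (use c in auto)
      moreover have "(c \<circ> ?t) \<circ> ?t = c" by (simp add: fun_eq_iff)
      ultimately show "c \<circ> ?t \<in> bicyclic ?Y (contract a v \<tau>)"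
        using key[of "c \<circ> ?t"] c by simp
    qed
  qed
  from bij_betw_same_card[OF this] show ?thesis by simp
qed

text \<open>Sort the maps \<open>c\<close> by the point \<open>v\<close> that
  \<open>c \<circ> \<tau>\<close> sends to \<open>a\<close>. A full cycle on more than one point has
  no fixed point, which rules out \<open>v = a\<close> by way of \<open>c \<circ> \<tau>\<close> and
  \<open>\<tau> v = a\<close> by way of \<open>c\<close>.\<close>

lemma card_bicyclic_rec:
  assumes X: "finite X" and \<tau>: "\<tau> permutes X" and a: "a \<in> X" "X \<noteq> {a}"
  shows "card (bicyclic X \<tau>) =
    (\<Sum>v | v \<in> X - {a} \<and> \<tau> v \<noteq> a. card (bicyclic (X - {a}) (contract a v \<tau>)))"
proof -
  let ?V = "{v. v \<in> X - {a} \<and> \<tau> v \<noteq> a}"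
  have "bicyclic X \<tau> = (\<Union>v\<in>?V. {c \<in> bicyclic X \<tau>. c (\<tau> v) = a})"
  proof (intro set_eqI iffI)
    fix c assume c: "c \<in> bicyclic X \<tau>"
    then have cp: "c permutes X" "cyclic_on c X" "cyclic_on (c \<circ> \<tau>) X"
      by (auto simp: bicyclic_def)
    define v where "v = inv \<tau> (inv c a)"
    have cv: "c (\<tau> v) = a"
      using cp(1) \<tau> by (simp add: v_def permutes_inverses)
    have "v \<in> X"
      unfolding v_def using cp(1) \<tau> a by (simp add: permutes_in_image permutes_inv)
    moreover have "v \<noteq> a" using cyclic_on_moves[OF cp(3) a] cv by auto
    moreover have "\<tau> v \<noteq> a" using cyclic_on_moves[OF cp(2) a] cv by auto
    ultimately show "c \<in> (\<Union>v\<in>?V. {c \<in> bicyclic X \<tau>. c (\<tau> v) = a})"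
      using c cv by blast
  qed auto
  moreover have "card (\<Union>v\<in>?V. {c \<in> bicyclic X \<tau>. c (\<tau> v) = a}) =
      (\<Sum>v\<in>?V. card {c \<in> bicyclic X \<tau>. c (\<tau> v) = a})"
  proof (rule card_UN_disjoint)
    show "finite ?V" using X by simp
    show "\<forall>v\<in>?V. finite {c \<in> bicyclic X \<tau>. c (\<tau> v) = a}"
      using finite_bicyclic[OF X] by auto
    show "\<forall>v\<in>?V. \<forall>w\<in>?V. v \<noteq> w \<longrightarrow>
        {c \<in> bicyclic X \<tau>. c (\<tau> v) = a} \<inter> {c \<in> bicyclic X \<tau>. c (\<tau> w) = a} = {}"
    proof (intro ballI impI equals0I)
      fix v w c
      assume "v \<noteq> w" "c \<in> {c \<in> bicyclic X \<tau>. c (\<tau> v) = a} \<inter> {c \<in> bicyclic X \<tau>. c (\<tau> w) = a}"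
      then have "c permutes X" "c (\<tau> v) = c (\<tau> w)" "v \<noteq> w" by (auto simp: bicyclic_def)
      then show False
        using \<tau> by (metis permutes_inverses(2))
    qed
  qed
  ultimately show ?thesis
    using card_bicyclic_fibre[OF X \<tau> a(1)] by (auto intro!: sum.cong)
qed

section \<open>Invariance under conjugation\<close>

lemma cyclic_on_conj:
  assumes "bij \<pi>" "cyclic_on c X"
  shows "cyclic_on (\<pi> \<circ> c \<circ> inv \<pi>) (\<pi> ` X)"
proof (rule cyclic_on_image[OF assms(2)])
  show "(\<pi> \<circ> c \<circ> inv \<pi>) (\<pi> x) = \<pi> (c x)" for x
    by (simp add: bij_is_inj[OF assms(1)])
qed

lemma permutes_conj:
  assumes "bij \<pi>" "c permutes X"
  shows "\<pi> \<circ> c \<circ> inv \<pi> permutes \<pi> ` X"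
proof (rule bij_imp_permutes)
  have "bij_betw \<pi> X (\<pi> ` X)" using assms(1) by (meson bij_betw_imageI bij_is_inj inj_on_subset subset_UNIV)
  moreover have "bij_betw (inv \<pi>) (\<pi> ` X) X"
    by (rule bij_betw_imageI, rule inj_on_subset[OF bij_is_inj[OF bij_imp_bij_inv[OF assms(1)]]])
      (simp_all add: assms(1) bij_is_inj image_inv_f_f)
  ultimately show "bij_betw (\<pi> \<circ> c \<circ> inv \<pi>) (\<pi> ` X) (\<pi> ` X)"
    using permutes_imp_bij[OF assms(2)] by (meson bij_betw_trans)
  show "(\<pi> \<circ> c \<circ> inv \<pi>) x = x" if "x \<notin> \<pi> ` X" for x
  proof -
    have "inv \<pi> x \<notin> X" using that assms(1) by (metis bij_inv_eq_iff image_eqI)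
    then show ?thesis using assms by (simp add: permutes_not_in bij_is_surj surj_f_inv_f)
  qed
qed

lemma card_bicyclic_conj_le:
  assumes X: "finite X" and \<pi>: "bij \<pi>"
  shows "card (bicyclic X \<tau>) \<le> card (bicyclic (\<pi> ` X) (\<pi> \<circ> \<tau> \<circ> inv \<pi>))"
proof (rule card_inj_on_le)
  let ?h = "\<lambda>c. \<pi> \<circ> c \<circ> inv \<pi>"
  have inv: "inv \<pi> (\<pi> x) = x" for x using \<pi> by (simp add: bij_is_inj)
  show "inj_on ?h (bicyclic X \<tau>)"
  proof (rule inj_onI)
    fix c d assume "?h c = ?h d"
    then have "\<pi> (c x) = \<pi> (d x)" for x by (metis comp_apply inv)
    then show "c = d" using inv by (metis ext)
  qed
  show "?h ` bicyclic X \<tau> \<subseteq> bicyclic (\<pi> ` X) (?h \<tau>)"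
  proof clarify
    fix c assume c: "c \<in> bicyclic X \<tau>"
    have "?h c \<circ> ?h \<tau> = ?h (c \<circ> \<tau>)" by (simp add: fun_eq_iff inv)
    then show "?h c \<in> bicyclic (\<pi> ` X) (?h \<tau>)"
      using c cyclic_on_conj[OF \<pi>] permutes_conj[OF \<pi>] by (simp add: bicyclic_def)
  qed
  show "finite (bicyclic (\<pi> ` X) (?h \<tau>))" using X by (simp add: finite_bicyclic)
qed

text \<open>The inequality is applied once to \<open>\<pi>\<close> and once to its inverse, which
  avoids a separate surjectivity argument.\<close>

lemma card_bicyclic_conj:
  assumes X: "finite X" and \<pi>: "bij \<pi>"
  shows "card (bicyclic (\<pi> ` X) (\<pi> \<circ> \<tau> \<circ> inv \<pi>)) = card (bicyclic X \<tau>)"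
proof (rule antisym)
  have "card (bicyclic (\<pi> ` X) (\<pi> \<circ> \<tau> \<circ> inv \<pi>)) \<le>
    card (bicyclic (inv \<pi> ` \<pi> ` X) (inv \<pi> \<circ> (\<pi> \<circ> \<tau> \<circ> inv \<pi>) \<circ> inv (inv \<pi>)))"
    using X \<pi> by (intro card_bicyclic_conj_le) (auto simp: bij_imp_bij_inv)
  also have "inv \<pi> \<circ> (\<pi> \<circ> \<tau> \<circ> inv \<pi>) \<circ> inv (inv \<pi>) = \<tau>"
    using \<pi> by (simp add: fun_eq_iff inv_inv_eq bij_is_inj)
  also have "inv \<pi> ` \<pi> ` X = X"
    using \<pi> by (simp add: bij_is_inj image_inv_f_f)
  finally show "card (bicyclic (\<pi> ` X) (\<pi> \<circ> \<tau> \<circ> inv \<pi>)) \<le> card (bicyclic X \<tau>)" .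
qed (rule card_bicyclic_conj_le[OF assms])

text \<open>Both sides redirect the same few arrows, so the order of the two deletions does not
  matter. The last hypothesis excludes the case where deleting \<open>a\<close> from
  \<open>s\<close> would turn \<open>v\<close> into a preimage of \<open>z\<close>.\<close>

lemma contract_contract:
  assumes s: "inj s" and "z \<noteq> a" "v \<noteq> a" "v \<noteq> z" "s v \<noteq> z" "s a \<noteq> a" "\<not> (s v = a \<and> s a = z)"
  shows "contract z v (contract a a s) = contract a a (contract z v s)"
proof
  fix x
  have [simp]: "s x = s y \<longleftrightarrow> x = y" for x y using s by (simp add: inj_eq)
  show "contract z v (contract a a s) x = contract a a (contract z v s) x"
    using assms(2-) by (auto simp: contract_def transpose_def)
qed

text \<open>With \<open>z = s d\<close>: the left side deletes \<open>z\<close> by itself and then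
  \<open>d\<close> by way of \<open>w\<close>, the right side deletes \<open>z\<close> by way of
  \<open>s w\<close> and then \<open>s w\<close> by itself. The remaining point sets differ by
  exchanging \<open>d\<close> and \<open>s w\<close>, hence the conjugation.\<close>

lemma contract_contract_conj:
  assumes s: "inj s" and ne: "s d \<noteq> d" "s w \<noteq> s d" "s w \<noteq> d" "s w \<noteq> s (s d)"
  shows "transpose d (s w) \<circ> contract d w (contract (s d) (s d) s) \<circ> transpose d (s w) =
    contract (s w) (s w) (contract (s d) (s w) s)"
proof
  fix x
  let ?r = "contract (s d) (s d) s" and ?t = "contract (s d) (s w) s"
  have [simp]: "s x = s y \<longleftrightarrow> x = y" for x y using s by (simp add: inj_eq)
  have [simp]: "w \<noteq> d" "d \<noteq> w" "s d \<noteq> d" "d \<noteq> s d" "s w \<noteq> d" "d \<noteq> s w" "w \<noteq> s d" "s d \<noteq> w"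
    using ne by auto
  \<comment> \<open>Writing all the maps through values of \<open>s\<close> reduces the claim to a
    finite case distinction; a fixed point \<open>w\<close> of \<open>s\<close> is treated
    separately.\<close>
  have r: "?r x = (if x = d then s (s d) else if x = s d then s d else s x)" for x
    by (simp add: contract_def transpose_def)
  have t: "?t x = (if x = s d then s d else if x = s w then s (s d) else if x = d then s (s w) else s x)" for x
    by (simp add: contract_def transpose_def)
  have L: "contract d w ?r x = (if x = d then d else if x = w then if s (s d) = d then s w else s (s d)
      else if x = s d then s d else if s x = d then s w else s x)" for x
    by (simp add: contract_def transpose_def r)
  have R: "contract (s w) (s w) ?t x = (if x = s w then s w else if x = w then s (s d) else
      if x = s d then s d else if x = d then (if s w = w then s (s d) else s (s w)) else s x)" for x
    by (simp add: contract_self transpose_def t)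
  show "(transpose d (s w) \<circ> contract d w ?r \<circ> transpose d (s w)) x = contract (s w) (s w) ?t x"
  proof (cases "s w = w")
    case True
    have "s (s d) \<noteq> w" "w \<noteq> s (s d)" "s x = w \<longleftrightarrow> x = w"
      using ne(4) True inj_eq[OF s] by metis+
    then show ?thesis
      unfolding o_apply L R using True
      by (cases "x = w"; cases "x = d"; simp add: transpose_def)
  next
    case False
    have "s x = s w \<longleftrightarrow> x = w" "s (s d) \<noteq> s w" "s d \<noteq> s w" "s (s w) = s w \<longleftrightarrow> s w = w"
      "s d = d \<longleftrightarrow> False"  "s w = d \<longleftrightarrow> False" "s w = s d \<longleftrightarrow> False" "w = s d \<longleftrightarrow> False" "w = d \<longleftrightarrow> False" by auto
    then show ?thesis
      unfolding o_apply L R using False unfolding transpose_def by (smt (verit))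
  qed
qed

section \<open>Odd permutations as products of an n-cycle and an (n-1)-cycle\<close>

text \<open>
  The summand for \<open>a\<close> is the number of \<open>card X\<close>-cycles \<open>c\<close> such that \<open>c \<circ> \<sigma>\<close> fixes \<open>a\<close> and is a cycle on
  \<open>X - {a}\<close>: the point \<open>a\<close> has been deleted from \<open>c\<close>.
\<close>

definition near_pairs :: "'a set \<Rightarrow> ('a \<Rightarrow> 'a) \<Rightarrow> nat" where
  "near_pairs X \<sigma> = (\<Sum>a | a \<in> X \<and> \<sigma> a \<noteq> a. card (bicyclic (X - {a}) (contract a a \<sigma>)))"

lemma bicyclic_singleton: "\<tau> permutes {y} \<Longrightarrow> card (bicyclic {y} \<tau>) = 1"
proof -
  assume "\<tau> permutes {y}"
  moreover have "cyclic_on id {y}" by (simp add: cyclic_on_def orbit_eq_singleton_iff[THEN iffD2])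
  ultimately have "bicyclic {y} \<tau> = {id}" by (auto simp: bicyclic_def)
  then show ?thesis by simp
qed

text \<open>Under these hypotheses both transpositions in \<open>contract\<close> are genuine, so
  the sign changes twice.\<close>

lemma evenperm_contract:
  assumes "finite X" "s permutes X" "v \<noteq> z" "s v \<noteq> z"
  shows "evenperm (contract z v s) \<longleftrightarrow> evenperm s"
proof -
  have "permutation s" using assms permutation_permutes by auto
  then show ?thesis
    using assms(3,4) unfolding contract_def
    by (simp add: evenperm_comp permutation_compose permutation_swap_id evenperm_swap)
qed

text \<open>Delete the preimage \<open>d\<close> of \<open>z\<close> from
  \<open>contract z z s\<close>. The summand for \<open>w\<close> in this recursion equals, after
  conjugation by \<open>transpose d (s w)\<close>, the summand for \<open>v = s w\<close> on the
  left-hand side.\<close>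

lemma sum_bicyclic_contract_contract:
  assumes X: "finite X" and s: "s permutes X" and z: "z \<in> X" "s z \<noteq> z" and c: "3 \<le> card X"
  shows "(\<Sum>v | v \<in> X \<and> v \<noteq> z \<and> s v \<noteq> z \<and> v \<noteq> s z.
      card (bicyclic (X - {z} - {v}) (contract v v (contract z v s)))) =
    card (bicyclic (X - {z}) (contract z z s))"
proof -
  define d where "d = inv s z"
  have sd: "s d = z" using s by (simp add: d_def permutes_inverses)
  have dX: "d \<in> X" using s z by (metis permutes_in_image sd)
  have dz: "d \<noteq> z" using sd z by auto
  have inj: "inj s" using s by (rule permutes_inj)
  have eq: "s x = s y \<longleftrightarrow> x = y" for x y using inj by (simp add: inj_eq)
  let ?r = "contract z z s"
  \<comment> \<open>Away from \<open>z\<close> and \<open>d\<close> the deletion changes nothing, so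
    the recursion condition \<open>?r w \<noteq> d\<close> becomes \<open>s w \<noteq> d\<close>,
    that is \<open>s v \<noteq> z\<close> for \<open>v = s w\<close>.\<close>
  have r: "?r w = s w" if "w \<noteq> z" "w \<noteq> d" for w
    using that sd eq[of w d] eq[of w z] by (auto simp: contract_self transpose_def)
  have ne: "X - {z} \<noteq> {d}"
  proof
    assume "X - {z} = {d}"
    then have "X = {z, d}" using z by auto
    then show False using c card_insert_le_m1[of 2 "{d}" z] by simp
  qed
  let ?W = "{w. w \<in> X - {z} - {d} \<and> ?r w \<noteq> d}"
  let ?V = "{v. v \<in> X \<and> v \<noteq> z \<and> s v \<noteq> z \<and> v \<noteq> s z}"
  have "card (bicyclic (X - {z}) ?r) =
      (\<Sum>w\<in>?W. card (bicyclic (X - {z} - {d}) (contract d w ?r)))"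
    by (rule card_bicyclic_rec) (use X s z dX dz ne contract_permutes[OF s z(1) z(1)] in auto)
  also have "\<dots> = (\<Sum>v\<in>?V. card (bicyclic (X - {z} - {v}) (contract v v (contract z v s))))"
  proof (rule sum.reindex_bij_witness[where i = "inv s" and j = s])
    fix w assume w: "w \<in> ?W"
    then have w': "w \<in> X" "w \<noteq> z" "w \<noteq> d" "s w \<noteq> d" using r by auto
    show "inv s (s w) = w" using s by (simp add: permutes_inverses)
    show "s w \<in> ?V"
      using w' s sd eq[of w d] eq[of w z] eq[of "s w" d] by (auto simp: permutes_in_image)
    let ?p = "transpose d (s w)"
    have "transpose d (s w) \<circ> contract d w ?r \<circ> transpose d (s w) =
        contract (s w) (s w) (contract z (s w) s)"
      using contract_contract_conj[OF inj, of d w] w' sd dz eq by (metis sd)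
    moreover have "?p ` (X - {z} - {d}) = X - {z} - {s w}"
    proof -
      have "s w \<in> X" "s w \<noteq> z" using w' s sd eq[of w d] by (auto simp: permutes_in_image)
      have "?p ` (X - {z} - {d}) = ?p ` X - ?p ` {z} - ?p ` {d}"
        by (simp add: image_set_diff)
      also have "?p ` X = X" using \<open>s w \<in> X\<close> dX by simp
      also have "?p ` {z} = {z}" using \<open>s w \<noteq> z\<close> dz by simp
      finally show ?thesis by simp
    qed
    ultimately show "card (bicyclic (X - {z} - {s w}) (contract (s w) (s w) (contract z (s w) s))) =
        card (bicyclic (X - {z} - {d}) (contract d w ?r))"
      using card_bicyclic_conj[of "X - {z} - {d}" ?p "contract d w ?r"] X by simp
  next
    fix v assume v: "v \<in> ?V"
    show sv: "s (inv s v) = v" using s by (simp add: permutes_inverses)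
    have "inv s v \<in> X" using v s by (simp add: permutes_in_image permutes_inv)
    moreover have "inv s v \<noteq> z" "inv s v \<noteq> d" "v \<noteq> d" using v sv sd by auto
    ultimately show "inv s v \<in> ?W" using r[of "inv s v"] sv by auto
  qed
  finally show ?thesis by simp
qed

text \<open>
  Deleting a second point \<open>z\<close> from the pairs with \<open>a \<noteq> z\<close> produces the summands \<open>a \<noteq> v\<close> of the right-hand side;
  the missing summands \<open>a = v\<close> add up to the term \<open>a = z\<close> of the left-hand side.
\<close>

lemma near_pairs_rec:
  assumes X: "finite X" and s: "s permutes X" and z: "z \<in> X" "s z \<noteq> z" and c: "3 \<le> card X"
  shows "near_pairs X s = (\<Sum>v | v \<in> X \<and> v \<noteq> z \<and> s v \<noteq> z. near_pairs (X - {z}) (contract z v s))"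
proof -
  have inj: "inj s" using s by (rule permutes_inj)
  have eq: "s x = s y \<longleftrightarrow> x = y" for x y using inj by (simp add: inj_eq)
  let ?A = "{a. a \<in> X \<and> a \<noteq> z \<and> s a \<noteq> a}"
  let ?V = "{v. v \<in> X \<and> v \<noteq> z \<and> s v \<noteq> z}"
  \<comment> \<open>\<open>?R a v\<close> says that \<open>v\<close> survives the deletion of
    \<open>a\<close> from \<open>s\<close> and is not turned into a preimage of \<open>z\<close> by
    it, so that \<open>z\<close> can be deleted by way of \<open>v\<close> afterwards.\<close>
  let ?R = "\<lambda>a v. a \<noteq> v \<and> \<not> (s v = a \<and> s a = z)"
  let ?g = "\<lambda>a v. card (bicyclic (X - {z} - {a}) (contract a a (contract z v s)))"
  have fin: "finite ?A" "finite ?V" using X by auto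
  have "near_pairs X s = card (bicyclic (X - {z}) (contract z z s)) +
      (\<Sum>a\<in>?A. card (bicyclic (X - {a}) (contract a a s)))"
  proof -
    have "{a. a \<in> X \<and> s a \<noteq> a} = insert z ?A" using z by auto
    then show ?thesis using fin by (simp add: near_pairs_def)
  qed
  also have "(\<Sum>a\<in>?A. card (bicyclic (X - {a}) (contract a a s))) = (\<Sum>a\<in>?A. \<Sum>v\<in>{v \<in> ?V. ?R a v}. ?g a v)"
  proof (rule sum.cong[OF refl])
    fix a assume a: "a \<in> ?A"
    have ne: "X - {a} \<noteq> {z}"
    proof
      assume "X - {a} = {z}"
      then have "X = {a, z}" using a by auto
      then show False using c card_insert_le_m1[of 2 "{z}" a] by simp
    qed
    have "card (bicyclic (X - {a}) (contract a a s)) =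
        (\<Sum>v | v \<in> X - {a} - {z} \<and> contract a a s v \<noteq> z.
           card (bicyclic (X - {a} - {z}) (contract z v (contract a a s))))"
      by (rule card_bicyclic_rec) (use X s z a ne contract_permutes[OF s, of a a] in auto)
    also have "\<dots> = (\<Sum>v\<in>{v \<in> ?V. ?R a v}. ?g a v)"
    proof (rule sum.cong)
      have cs: "contract a a s v = (if s v = a then s a else s v)" if "v \<noteq> a" for v
        using that eq[of v a] by (auto simp: contract_self transpose_def)
      show S: "{v. v \<in> X - {a} - {z} \<and> contract a a s v \<noteq> z} = {v \<in> ?V. ?R a v}"
      proof (rule set_eqI)
        fix v
        show "v \<in> {v. v \<in> X - {a} - {z} \<and> contract a a s v \<noteq> z} \<longleftrightarrow> v \<in> {v \<in> ?V. ?R a v}"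
        proof (cases "v = a")
          case False
          then show ?thesis using a cs[OF False] by (cases "s v = a") auto
        qed simp
      qed
      fix v assume "v \<in> {v \<in> ?V. ?R a v}"
      then have "contract z v (contract a a s) = contract a a (contract z v s)"
        using a by (intro contract_contract[OF inj]) auto
      moreover have "X - {a} - {z} = X - {z} - {a}" by auto
      ultimately show "card (bicyclic (X - {a} - {z}) (contract z v (contract a a s))) = ?g a v"
        by simp
    qed
    finally show "card (bicyclic (X - {a}) (contract a a s)) = (\<Sum>v\<in>{v \<in> ?V. ?R a v}. ?g a v)" .
  qed
  also have "\<dots> = (\<Sum>v\<in>?V. \<Sum>a\<in>{a \<in> ?A. ?R a v}. ?g a v)"
    by (rule sum.swap_restrict[OF fin])
  also have "card (bicyclic (X - {z}) (contract z z s)) = (\<Sum>v\<in>?V. if v \<noteq> s z then ?g v v else 0)"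
  proof -
    have "(\<Sum>v\<in>?V. if v \<noteq> s z then ?g v v else 0) = (\<Sum>v\<in>{v\<in>?V. v \<noteq> s z}. ?g v v)"
      by (rule sum.inter_filter[OF fin(2), symmetric])
    also have "{v\<in>?V. v \<noteq> s z} = {v. v \<in> X \<and> v \<noteq> z \<and> s v \<noteq> z \<and> v \<noteq> s z}" by auto
    finally show ?thesis using sum_bicyclic_contract_contract[OF assms] by simp
  qed
  also have "(\<Sum>v\<in>?V. if v \<noteq> s z then ?g v v else 0) + (\<Sum>v\<in>?V. \<Sum>a\<in>{a \<in> ?A. ?R a v}. ?g a v) =
      (\<Sum>v\<in>?V. (if v \<noteq> s z then ?g v v else 0) + (\<Sum>a\<in>{a \<in> ?A. ?R a v}. ?g a v))"
    by (simp add: sum.distrib)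
  also have "\<dots> = (\<Sum>v\<in>?V. near_pairs (X - {z}) (contract z v s))"
  proof (rule sum.cong[OF refl])
    fix v assume v: "v \<in> ?V"
    let ?t = "contract z v s" and ?B = "{a \<in> ?A. ?R a v}"
    have tv: "?t v = s z" using v z eq[of z v] by (auto simp: contract_def transpose_def)
    have ta: "?t a = (if s a = z then s v else s a)" if "a \<noteq> z" "a \<noteq> v" for a
      using that eq[of a v] by (auto simp: contract_def transpose_def)
    have moved: "?t a \<noteq> a \<longleftrightarrow> s a \<noteq> a \<and> \<not> (s v = a \<and> s a = z)" if "a \<noteq> z" "a \<noteq> v" for a
      using ta[OF that] that eq[of a v] by auto
    have "{a. a \<in> X - {z} \<and> ?t a \<noteq> a} = (if v \<noteq> s z then insert v ?B else ?B)"
    proof (rule set_eqI)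
      fix a
      show "a \<in> {a. a \<in> X - {z} \<and> ?t a \<noteq> a} \<longleftrightarrow> a \<in> (if v \<noteq> s z then insert v ?B else ?B)"
      proof (cases "a = v")
        case True then show ?thesis using v tv by auto
      next
        case False
        then show ?thesis using moved[of a] by auto
      qed
    qed
    then show "(if v \<noteq> s z then ?g v v else 0) + (\<Sum>a\<in>?B. ?g a v) = near_pairs (X - {z}) ?t"
      using X by (simp add: near_pairs_def)
  qed
  finally show ?thesis .
qed

text \<open>Induction on the number of points. Oddness provides a moved point \<open>z\<close> and
  is inherited by every admissible \<open>contract z v s\<close>, so each summand of
  \<open>near_pairs_rec\<close> is known and only the number of \<open>v\<close> has to be
  counted.\<close>

lemma near_pairs_odd:
  assumes "finite X" "s permutes X" "\<not> evenperm s"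
  shows "near_pairs X s = 2 * fact (card X - 2)"
  using assms
proof (induction "card X" arbitrary: X s rule: less_induct)
  case less
  note X = \<open>finite X\<close> and s = \<open>s permutes X\<close>
  have "s \<noteq> id" using less.prems by auto
  then obtain z where z: "s z \<noteq> z" by (metis eq_id_iff)
  have zX: "z \<in> X" "s z \<in> X"
    using s z permutes_not_in[OF s, of z] by (auto simp: permutes_in_image)
  have sub: "{z, s z} \<subseteq> X" using zX by auto
  have c2: "card {z, s z} = 2" using z by (simp add: card_insert_if)
  then have "2 \<le> card X" using card_mono[OF X sub] by simp
  then consider "card X = 2" | "3 \<le> card X" by linarith
  then show ?case
  proof cases
    \<comment> \<open>On two points \<open>s\<close> is the swap, and each of the two points
      contributes the single cycle on the other one.\<close>
    case 1
    then have Xe: "X = {z, s z}" using card_subset_eq[OF X sub] c2 by simp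
    have ssz: "s (s z) = z"
      using s z Xe by (metis insertE permutes_in_image permutes_inj injD singletonD zX(2))
    have "{a. a \<in> X \<and> s a \<noteq> a} = X" using z ssz Xe by auto
    moreover have "card (bicyclic (X - {a}) (contract a a s)) = 1" if "a \<in> X" for a
    proof -
      have "\<exists>y. X - {a} = {y}" using that z by (auto simp: Xe)
      then obtain y where y: "X - {a} = {y}" by auto
      show ?thesis
        using bicyclic_singleton contract_permutes[OF s that that] unfolding y by metis
    qed
    ultimately show ?thesis using 1 by (simp add: near_pairs_def)
  next
    case 2
    let ?V = "{v. v \<in> X \<and> v \<noteq> z \<and> s v \<noteq> z}"
    have "near_pairs X s = (\<Sum>v\<in>?V. near_pairs (X - {z}) (contract z v s))"
      by (rule near_pairs_rec[OF X s zX(1) z 2])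
    also have "\<dots> = (\<Sum>v\<in>?V. 2 * fact (card X - 3))"
    proof (rule sum.cong[OF refl])
      fix v assume v: "v \<in> ?V"
      have "near_pairs (X - {z}) (contract z v s) = 2 * fact (card (X - {z}) - 2)"
      proof (rule less.hyps)
        show "card (X - {z}) < card X" using card_Diff1_less[OF X zX(1)] .
        show "contract z v s permutes (X - {z})" using contract_permutes[OF s] v zX by auto
        show "\<not> evenperm (contract z v s)" using evenperm_contract[OF X s] v less.prems by auto
      qed (use X in simp)
      also have "card (X - {z}) - 2 = card X - 3" using X zX by simp
      finally show "near_pairs (X - {z}) (contract z v s) = 2 * fact (card X - 3)" .
    qed
    also have "\<dots> = card ?V * (2 * fact (card X - 3))" by simp
    also have "card ?V = card X - 2"
    proof -
      \<comment> \<open>Exactly \<open>z\<close> and its preimage are excluded, and they are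
        distinct because \<open>z\<close> is moved.\<close>
      have e: "?V = X - {z, inv s z}" using s by (auto simp: permutes_inverses permutes_inv_eq)
      have "inv s z \<in> X" "inv s z \<noteq> z"
        using s zX z by (auto simp: permutes_in_image permutes_inv permutes_inv_eq)
      then show ?thesis unfolding e using zX X by (subst card_Diff_subset) (auto simp: card_insert_if)
    qed
    also have "(card X - 2) * (2 * fact (card X - 3)) = 2 * (fact (card X - 2) :: nat)"
    proof -
      obtain k where "card X = k + 3" using 2 by (metis add.commute le_Suc_ex)
      then show ?thesis by (simp add: algebra_simps)
    qed
    finally show ?thesis .
  qed
qed

section \<open>Cycle types\<close>

text \<open>This is \<open>cycle_type\<close> over an arbitrary carrier: the inductions insert and
  delete points and so need point sets other than \<open>{1..n}\<close>.\<close>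

definition ctype :: "'a set \<Rightarrow> ('a \<Rightarrow> 'a) \<Rightarrow> nat multiset" where
  "ctype X \<sigma> = image_mset card (mset_set (orbit \<sigma> ` X))"

lemma orbit_eq_of_mem:
  assumes "finite X" "\<sigma> permutes X" "y \<in> orbit \<sigma> x"
  shows "orbit \<sigma> y = orbit \<sigma> x"
  using cyclic_on_orbit[OF assms(2,1)] assms(3) by (rule orbit_cyclic_eq3)

lemma self_mem_orbit:
  assumes "finite X" "\<sigma> permutes X"
  shows "x \<in> orbit \<sigma> x"
  using assms by (intro permutation_self_in_orbit) (auto simp: permutation_permutes)

text \<open>On the orbit of \<open>j\<close> this is the insertion of \<open>a\<close> into a cycle;
  the other orbits inside \<open>Y\<close> avoid \<open>a\<close> and \<open>j\<close>, and there
  the two maps agree.\<close>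

lemma orbit_insert_transpose:
  assumes Y: "finite Y" "b permutes Y" and a: "a \<notin> Y" and j: "j \<in> Y"
  shows "x \<in> insert a (orbit b j) \<Longrightarrow> orbit (b \<circ> transpose a j) x = insert a (orbit b j)"
    and "x \<in> Y - orbit b j \<Longrightarrow> orbit (b \<circ> transpose a j) x = orbit b x"
proof -
  let ?O = "orbit b j"
  have OY: "?O \<subseteq> Y" using permutes_orbit_subset[OF Y(2) j] .
  have jO: "j \<in> ?O" using self_mem_orbit[OF Y] .
  have ba: "b a = a" using Y a by (simp add: permutes_not_in)
  have "cyclic_on (b \<circ> transpose a j) (insert a ?O) \<longleftrightarrow> cyclic_on b ?O"
    by (rule cyclic_on_insert_iff) (use a OY jO ba in \<open>auto intro: orbit.step\<close>)
  then have "cyclic_on (b \<circ> transpose a j) (insert a ?O)"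
    using cyclic_on_orbit[OF Y(2,1)] by simp
  then show "x \<in> insert a ?O \<Longrightarrow> orbit (b \<circ> transpose a j) x = insert a ?O"
    by (rule orbit_cyclic_eq3)
  assume x: "x \<in> Y - ?O"
  show "orbit (b \<circ> transpose a j) x = orbit b x"
  proof (rule orbit_cong)
    show "x \<in> orbit b x" by (rule self_mem_orbit[OF Y])
    fix y assume y: "y \<in> orbit b x"
    then have "y \<in> Y" using permutes_orbit_subset[OF Y(2)] x by auto
    then have "y \<noteq> a" using a by auto
    moreover have "y \<noteq> j"
      using orbit_eq_of_mem[OF Y y] self_mem_orbit[OF Y, of x] x by auto
    ultimately show "(b \<circ> transpose a j) y = b y" by simp
  qed
qed

text \<open>The second statement guarantees that the multiset difference in the first really removes
  an element.\<close>

lemma ctype_insert_transpose: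
  assumes Y: "finite Y" "b permutes Y" and a: "a \<notin> Y" and j: "j \<in> Y"
  shows "ctype (insert a Y) (b \<circ> transpose a j) =
      add_mset (Suc (card (orbit b j))) (ctype Y b - {#card (orbit b j)#})"
    and "card (orbit b j) \<in># ctype Y b"
proof -
  let ?O = "orbit b j"
  let ?R = "orbit b ` Y - {?O}"
  have OY: "?O \<subseteq> Y" using permutes_orbit_subset[OF Y(2) j] .
  have fO: "finite ?O" using OY Y finite_subset by auto
  have jO: "j \<in> ?O" using self_mem_orbit[OF Y] .
  have "orbit b ` (Y - ?O) = ?R"
    using orbit_eq_of_mem[OF Y] self_mem_orbit[OF Y] by blast
  moreover have "orbit (b \<circ> transpose a j) ` (Y - ?O) = orbit b ` (Y - ?O)"
    using orbit_insert_transpose(2)[OF assms] by (intro image_cong) auto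
  moreover have "orbit (b \<circ> transpose a j) ` insert a ?O = {insert a ?O}"
    using orbit_insert_transpose(1)[OF assms] by (auto simp: image_def)
  moreover have "insert a Y = insert a ?O \<union> (Y - ?O)" using OY by auto
  ultimately have new: "orbit (b \<circ> transpose a j) ` insert a Y = insert (insert a ?O) ?R"
    by (metis image_Un insert_is_Un)
  have "insert a ?O \<notin> ?R"
    using permutes_orbit_subset[OF Y(2)] a by blast
  then have c1: "ctype (insert a Y) (b \<circ> transpose a j) = add_mset (Suc (card ?O)) (image_mset card (mset_set ?R))"
    using new Y fO a OY by (auto simp: ctype_def card_insert_if)
  have old: "orbit b ` Y = insert ?O ?R" using j by auto
  have c2: "ctype Y b = add_mset (card ?O) (image_mset card (mset_set ?R))"
    unfolding ctype_def by (subst old, subst mset_set.insert) (use Y in auto)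
  show "card ?O \<in># ctype Y b" using c2 by simp
  show "ctype (insert a Y) (b \<circ> transpose a j) = add_mset (Suc (card ?O)) (ctype Y b - {#card ?O#})"
    using c1 c2 by simp
qed

lemma ctype_insert_fixed:
  assumes Y: "finite Y" "b permutes Y" and a: "a \<notin> Y"
  shows "ctype (insert a Y) b = add_mset 1 (ctype Y b)"
proof -
  have "orbit b a = {a}" using Y a by (simp add: orbit_eq_singleton_iff permutes_not_in)
  moreover have "{a} \<notin> orbit b ` Y"
    using permutes_orbit_subset[OF Y(2)] a by blast
  ultimately show ?thesis using Y by (simp add: ctype_def)
qed

text \<open>The orbits of size \<open>i\<close> are disjoint and cover these points, with
  \<open>i\<close> points each.\<close>

lemma card_orbit_size:
  assumes X: "finite X" "\<sigma> permutes X"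
  shows "card {x \<in> X. card (orbit \<sigma> x) = i} = i * count (ctype X \<sigma>) i"
proof -
  let ?C = "{S \<in> orbit \<sigma> ` X. card S = i}"
  have U: "\<Union>?C = {x \<in> X. card (orbit \<sigma> x) = i}"
    using self_mem_orbit[OF X] permutes_orbit_subset[OF X(2)] orbit_eq_of_mem[OF X] by fastforce
  have "count (ctype X \<sigma>) i = (\<Sum>y\<in>card -` {i} \<inter> orbit \<sigma> ` X. 1)"
    unfolding ctype_def count_image_mset using X by (auto intro!: sum.cong)
  also have "card -` {i} \<inter> orbit \<sigma> ` X = ?C" by auto
  finally have "count (ctype X \<sigma>) i = card ?C" by simp
  moreover have "i * card ?C = card (\<Union>?C)"
  proof (rule card_partition)
    show "finite ?C" using X by simp
    show "finite (\<Union>?C)" unfolding U using X by simp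
    show "c1 \<inter> c2 = {}" if "c1 \<in> ?C" "c2 \<in> ?C" "c1 \<noteq> c2" for c1 c2
      using that orbit_eq_of_mem[OF X] by blast
  qed auto
  ultimately show ?thesis using U by simp
qed

lemma orbit_conj:
  assumes X: "finite X" "\<sigma> permutes X" and \<pi>: "bij \<pi>"
  shows "orbit (\<pi> \<circ> \<sigma> \<circ> inv \<pi>) (\<pi> x) = \<pi> ` orbit \<sigma> x"
  by (rule orbit_cyclic_eq3[OF cyclic_on_conj[OF \<pi> cyclic_on_orbit[OF X(2,1)]]])
    (use self_mem_orbit[OF X] in auto)

lemma card_image_bij: "bij \<pi> \<Longrightarrow> card (\<pi> ` S) = card S"
  by (meson bij_is_inj card_image inj_on_subset subset_UNIV)

lemma ctype_conj:
  assumes X: "finite X" "\<sigma> permutes X" and \<pi>: "bij \<pi>"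
  shows "ctype (\<pi> ` X) (\<pi> \<circ> \<sigma> \<circ> inv \<pi>) = ctype X \<sigma>"
proof -
  have "orbit (\<pi> \<circ> \<sigma> \<circ> inv \<pi>) ` \<pi> ` X = (`) \<pi> ` (orbit \<sigma> ` X)"
    using orbit_conj[OF assms] by (simp add: image_image)
  moreover have "inj_on ((`) \<pi>) (orbit \<sigma> ` X)"
    using \<pi> by (meson bij_is_inj inj_image_eq_iff inj_onI)
  then have "mset_set ((`) \<pi> ` (orbit \<sigma> ` X)) = image_mset ((`) \<pi>) (mset_set (orbit \<sigma> ` X))"
    by (simp add: image_mset_mset_set)
  ultimately show ?thesis
    using card_image_bij[OF \<pi>] by (simp add: ctype_def multiset.map_comp comp_def)
qed

text \<open>In the second case \<open>j\<close> is the preimage of \<open>a\<close>, and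
  \<open>b\<close> is \<open>s\<close> with \<open>a\<close> cut out of its cycle. This is the case
  analysis behind the inductions over the carrier.\<close>

lemma permutes_insert_cases:
  assumes "s permutes insert a Y"
  obtains (fixed) "s permutes Y" "s a = a"
  | (moved) b j where "b permutes Y" "j \<in> Y" "s = b \<circ> transpose a j" "s a \<noteq> a"
proof (cases "s a = a")
  case True
  then have "s permutes Y" using assms by (auto intro: permutes_superset)
  then show ?thesis using True fixed by blast
next
  case False
  define j where "j = inv s a"
  have sj: "s j = a" using assms by (simp add: j_def permutes_inverses)
  then have "j \<in> insert a Y" "j \<noteq> a" using assms False permutes_in_image[OF assms, of j] by auto
  then have jY: "j \<in> Y" by simp
  have "s \<circ> transpose a j permutes Y"
  proof (rule permutes_superset)
    show "s \<circ> transpose a j permutes insert a Y"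
      by (intro permutes_compose permutes_swap_id assms) (use jY in auto)
  qed (use sj in auto)
  moreover have "s = (s \<circ> transpose a j) \<circ> transpose a j" by (simp add: fun_eq_iff)
  ultimately show ?thesis using jY False moved by blast
qed

text \<open>A new fixed point raises both the number of points and the number of cycles and keeps
  the sign; an insertion into a cycle raises only the number of points and costs one
  transposition.\<close>

lemma evenperm_iff_ctype:
  assumes "finite X" "s permutes X"
  shows "evenperm s \<longleftrightarrow> even (card X + size (ctype X s))"
  using assms
proof (induction X arbitrary: s rule: finite_induct)
  case empty
  then show ?case by (simp add: ctype_def)
next
  case (insert a Y)
  from insert.prems show ?case
  proof (cases rule: permutes_insert_cases)
    case fixed
    then show ?thesis
      using insert.IH[of s] insert.hyps ctype_insert_fixed[of Y s a] by simp
  next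
    case (moved b j)
    have "permutation b" using moved(1) insert.hyps by (auto simp: permutation_permutes)
    moreover have "a \<noteq> j" using moved(2) insert.hyps by auto
    ultimately have "evenperm s \<longleftrightarrow> \<not> evenperm b"
      using moved(3) by (simp add: evenperm_comp permutation_swap_id evenperm_swap)
    moreover have "size (ctype (insert a Y) s) = size (ctype Y b)"
      using ctype_insert_transpose[of Y b a j] moved insert.hyps by (simp add: size_Suc_Diff1)
    ultimately show ?thesis
      using insert.IH[OF moved(1)] insert.hyps by simp
  qed
qed

lemma cyclic_on_iff_ctype:
  assumes X: "finite X" "X \<noteq> {}" "s permutes X"
  shows "cyclic_on s X \<longleftrightarrow> ctype X s = {#card X#}"
proof
  assume "cyclic_on s X"
  then have "orbit s ` X = {X}"
    using X orbit_cyclic_eq3 by fastforce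
  then show "ctype X s = {#card X#}" by (simp add: ctype_def)
next
  assume L: "ctype X s = {#card X#}"
  then have "size (ctype X s) = 1" by simp
  then have "card (orbit s ` X) = 1" by (simp add: ctype_def)
  then obtain S where S: "orbit s ` X = {S}" by (rule card_1_singletonE)
  then have "card S = card X" using L by (simp add: ctype_def)
  moreover obtain x where x: "x \<in> X" using X by auto
  moreover have "orbit s x = S" using x S by auto
  ultimately have "orbit s x = X"
    using card_subset_eq[OF X(1) permutes_orbit_subset[OF X(3) x]] by simp
  then show "cyclic_on s X" using cyclic_on_orbit[OF X(3,1), of x] by simp
qed

section \<open>Any two full cycles are conjugate\<close>

lemma cyclic_on_remove:
  assumes X: "finite X" "c permutes X" "cyclic_on c X" "w \<in> X" "X \<noteq> {w}"
  obtains u e where "u \<in> X - {w}" "c = e \<circ> transpose w u" "e permutes (X - {w})" "cyclic_on e (X - {w})"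
proof -
  have "c permutes insert w (X - {w})" using X by (simp add: insert_absorb)
  then show ?thesis
  proof (cases rule: permutes_insert_cases)
    case fixed
    then show ?thesis using cyclic_on_moves[OF X(3-5)] by simp
  next
    case (moved e u)
    then have "cyclic_on e (X - {w})"
      using cyclic_on_insert_iff[of w "X - {w}" e u] X
      by (simp add: insert_absorb permutes_not_in permutes_image)
    then show ?thesis using moved that by blast
  qed
qed

text \<open>The marked points make the induction work: deleting \<open>w\<close> and
  \<open>w'\<close> leaves shorter cycles whose new marks are the predecessors \<open>u\<close> and
  \<open>u'\<close>, so extending the map by \<open>w \<mapsto> w'\<close> stays compatible with
  both cycles.\<close>

lemma cyclic_on_intertwine:
  assumes "finite X" "c permutes X" "cyclic_on c X" "w \<in> X"
    and "finite X'" "c' permutes X'" "cyclic_on c' X'" "w' \<in> X'" "card X' = card X"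
  shows "\<exists>\<pi>. bij_betw \<pi> X X' \<and> \<pi> w = w' \<and> (\<forall>x\<in>X. c' (\<pi> x) = \<pi> (c x))"
  using assms
proof (induction "card X" arbitrary: X c w X' c' w' rule: less_induct)
  case less
  note prems = less.prems
  show ?case
  proof (cases "X = {w}")
    case True
    then have "card X' = 1" using prems by simp
    then have X': "X' = {w'}" using prems(8) by (metis card_1_singletonE singletonD)
    then have "c w = w" "c' w' = w'" using prems True by auto
    then show ?thesis using True X' by (intro exI[of _ "\<lambda>_. w'"]) (auto simp: bij_betw_def)
  next
    case False
    obtain u e where e: "u \<in> X - {w}" "c = e \<circ> transpose w u" "e permutes (X - {w})" "cyclic_on e (X - {w})"
      using cyclic_on_remove[OF prems(1-4) False] .
    have "X' \<noteq> {w'}"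
    proof
      assume "X' = {w'}"
      then have "card X = 1" using prems by simp
      then show False using False prems(4) by (metis card_1_singletonE singletonD)
    qed
    then obtain u' e' where e': "u' \<in> X' - {w'}" "c' = e' \<circ> transpose w' u'" "e' permutes (X' - {w'})"
        "cyclic_on e' (X' - {w'})"
      using cyclic_on_remove[OF prems(5-8)] by metis
    have "\<exists>\<pi>. bij_betw \<pi> (X - {w}) (X' - {w'}) \<and> \<pi> u = u' \<and> (\<forall>x\<in>X - {w}. e' (\<pi> x) = \<pi> (e x))"
      by (rule less.hyps[OF card_Diff1_less[OF prems(1,4)]]) (use prems e e' in auto)
    then obtain \<pi> where \<pi>: "bij_betw \<pi> (X - {w}) (X' - {w'})" "\<pi> u = u'"
        "\<And>x. x \<in> X - {w} \<Longrightarrow> e' (\<pi> x) = \<pi> (e x)" by auto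
    let ?p = "\<pi>(w := w')"
    have "bij_betw ?p (X - {w}) (X' - {w'})"
      by (rule iffD1[OF bij_betw_cong \<pi>(1)]) auto
    then have "bij_betw ?p (insert w (X - {w})) (insert w' (X' - {w'}))"
      using bij_betw_combine[of ?p "X - {w}" "X' - {w'}" "{w}" "{w'}"] by simp
    then have "bij_betw ?p X X'" using prems by (simp add: insert_absorb)
    moreover have "c' (?p x) = ?p (c x)" if x: "x \<in> X" for x
    proof -
      have ew: "e w = w" "e' w' = w'" using e e' by (simp_all add: permutes_not_in)
      have eX: "e y \<in> X - {w}" if "y \<in> X - {w}" for y
        using that permutes_in_image[OF e(3)] by blast
      consider "x = w" | "x = u" | "x \<in> X - {w}" "x \<noteq> u" using x by blast
      then show ?thesis
      proof cases
        case 1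
        then show ?thesis using e(1,2) e'(1,2) eX[OF e(1)] \<pi>(2) \<pi>(3)[OF e(1)] by auto
      next
        case 2
        then show ?thesis using e(1,2) e'(1,2) ew \<pi>(2) by auto
      next
        case 3
        have "\<pi> x \<in> X' - {w'}" using \<pi>(1) 3 by (auto dest: bij_betwE)
        moreover have "\<pi> x \<noteq> u'"
          using \<pi>(1,2) 3 e(1) by (metis bij_betw_inv_into_left)
        ultimately show ?thesis
          using e(2) e'(2) 3 eX[OF 3(1)] \<pi>(3)[OF 3(1)] by auto
      qed
    qed
    ultimately show ?thesis by (intro exI[of _ ?p]) auto
  qed
qed

lemma cyclic_on_conjugate:
  assumes X: "finite X" and c: "c permutes X" "cyclic_on c X" and c': "c' permutes X" "cyclic_on c' X"
  obtains \<pi> where "\<pi> permutes X" "c' = \<pi> \<circ> c \<circ> inv \<pi>"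
proof -
  obtain w where w: "w \<in> X" using c(2) by (auto simp: cyclic_on_def)
  obtain p where p: "bij_betw p X X" "\<And>x. x \<in> X \<Longrightarrow> c' (p x) = p (c x)"
    using cyclic_on_intertwine[OF X c w X c' w refl] by auto
  \<comment> \<open>Outside \<open>X\<close> the intertwining map is arbitrary; it is replaced by
    the identity there to obtain a permutation of \<open>X\<close>.\<close>
  define \<pi> where "\<pi> = restrict_id p X"
  have \<pi>: "\<pi> permutes X" unfolding \<pi>_def by (rule permutes_restrict_id[OF p(1)])
  have "c' (\<pi> x) = \<pi> (c x)" for x
    using p(2)[of x] c c' permutes_in_image[OF c(1), of x]
    by (cases "x \<in> X") (auto simp: \<pi>_def permutes_not_in)
  then have "c' = \<pi> \<circ> c \<circ> inv \<pi>"
    using \<pi> by (metis (no_types, lifting) comp_assoc comp_id fun.map_comp fun_eq_iff o_apply permutes_inv_o(1))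
  then show ?thesis using that \<pi> by blast
qed

section \<open>The standard cycle on \<open>{1..N}\<close>\<close>

lemma long_cycle_permutes:
  assumes "1 \<le> N"
  shows "long_cycle N permutes {1..N}"
proof (rule bij_imp_permutes)
  have "inj_on (long_cycle N) {1..N}"
    by (auto simp: inj_on_def long_cycle_def split: if_splits)
  moreover have "long_cycle N ` {1..N} \<subseteq> {1..N}"
    by (auto simp: long_cycle_def)
  ultimately show "bij_betw (long_cycle N) {1..N} {1..N}"
    by (simp add: bij_betw_def endo_inj_surj)
qed (use assms in \<open>auto simp: long_cycle_def\<close>)

text \<open>A closed set contains with a point everything above it up to \<open>N\<close>, then
  \<open>1\<close> by wrapping around, hence all of \<open>{1..N}\<close>.\<close>

lemma long_cycle_cyclic:
  assumes "1 \<le> N"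
  shows "cyclic_on (long_cycle N) {1..N}"
proof -
  have "S = {1..N}" if S: "S \<subseteq> {1..N}" "S \<noteq> {}" "long_cycle N ` S \<subseteq> S" for S
  proof -
    have step: "y \<in> S" if "x \<in> S" "x \<le> y" "y \<le> N" for x y
      using that(2,3)
    proof (induction y rule: dec_induct)
      case base
      then show ?case using that by simp
    next
      case (step n)
      then have "n \<in> S" by simp
      then have "long_cycle N n \<in> S" using S(3) by blast
      moreover have "long_cycle N n = Suc n" using step that S(1) by (auto simp: long_cycle_def)
      ultimately show ?case by simp
    qed
    obtain x where x: "x \<in> S" using S by auto
    then have "N \<in> S" using step[of x N] S by auto
    then have "long_cycle N N \<in> S" using S(3) by blast
    then have "1 \<in> S" by (simp add: long_cycle_def)
    then show ?thesis using step[of 1] S(1) by auto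
  qed
  moreover have "long_cycle N ` {1..N} \<subseteq> {1..N}" by (auto simp: long_cycle_def)
  ultimately show ?thesis
    unfolding cyclic_on_iff_minimal using assms by (intro conjI) auto
qed

section \<open>Counting permutations of a given cycle type\<close>

definition of_type :: "'a set \<Rightarrow> nat multiset \<Rightarrow> ('a \<Rightarrow> 'a) set" where
  "of_type X mu = {\<sigma>. \<sigma> permutes X \<and> ctype X \<sigma> = mu}"

lemma finite_of_type: "finite X \<Longrightarrow> finite (of_type X mu)"
  unfolding of_type_def by (rule finite_subset[OF _ finite_permutations[of X]]) auto

text \<open>The type is invariant under conjugation. This carries the averaging arguments over
  points and over full cycles.\<close>

lemma sum_of_type_conj:
  assumes X: "finite X" and \<pi>: "\<pi> permutes X"
  shows "(\<Sum>\<sigma>\<in>of_type X mu. f (\<pi> \<circ> \<sigma> \<circ> inv \<pi>)) = (\<Sum>\<sigma>\<in>of_type X mu. f \<sigma>)"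
proof -
  let ?h = "\<lambda>\<pi> \<sigma>. \<pi> \<circ> \<sigma> \<circ> inv \<pi>"
  have closed: "?h p \<sigma> \<in> of_type X mu" if "p permutes X" "\<sigma> \<in> of_type X mu" for p \<sigma>
    using that ctype_conj[OF X _ permutes_bij[OF that(1)], of \<sigma>] permutes_image[OF that(1)]
      permutes_conj[OF permutes_bij[OF that(1)], of \<sigma> X]
    by (auto simp: of_type_def)
  show ?thesis
  proof (rule sum.reindex_bij_witness[where i = "?h (inv \<pi>)" and j = "?h \<pi>"])
    show "?h (inv \<pi>) (?h \<pi> \<sigma>) = \<sigma>" "?h \<pi> (?h (inv \<pi>) \<sigma>) = \<sigma>" for \<sigma>
      using \<pi> by (simp_all add: fun_eq_iff permutes_inverses permutes_inv_inv)
  qed (use closed \<pi> permutes_inv[OF \<pi>] in auto)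
qed

lemma contract_self_transpose:
  assumes "inj b" "b a = a" "j \<noteq> a"
  shows "contract a a (b \<circ> transpose a j) = b"
proof
  fix x
  have eq: "b x = b y \<longleftrightarrow> x = y" for x y using assms(1) by (simp add: inj_eq)
  have "b x = a \<longleftrightarrow> x = a" using eq[of x a] assms(2) by simp
  then show "contract a a (b \<circ> transpose a j) x = b x"
  proof (cases "x = a")
    case False
    then show ?thesis using assms(2,3) eq \<open>b x = a \<longleftrightarrow> x = a\<close>
      by (auto simp: contract_self transpose_def)
  qed (simp add: assms(2))
qed

lemma contract_conj:
  assumes "bij \<pi>"
  shows "contract (\<pi> a) (\<pi> v) (\<pi> \<circ> \<sigma> \<circ> inv \<pi>) = \<pi> \<circ> contract a v \<sigma> \<circ> inv \<pi>"
proof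
  fix x
  have inv: "inv \<pi> (\<pi> y) = y" for y
    using assms by (simp add: bij_is_inj)
  have eq: "\<pi> y = \<pi> z \<longleftrightarrow> y = z" for y z using assms by (simp add: bij_is_inj inj_eq)
  have t: "transpose (\<pi> y) (\<pi> z) (\<pi> w) = \<pi> (transpose y z w)" for y z w
    by (simp add: transpose_def eq)
  show "contract (\<pi> a) (\<pi> v) (\<pi> \<circ> \<sigma> \<circ> inv \<pi>) x = (\<pi> \<circ> contract a v \<sigma> \<circ> inv \<pi>) x"
  proof -
    obtain y where x: "x = \<pi> y" using assms by (metis bij_pointE)
    show ?thesis unfolding x contract_def by (simp add: inv t)
  qed
qed

text \<open>Each \<open>\<sigma>\<close> on the left arises from
  \<open>\<beta> = contract a a \<sigma>\<close> by inserting \<open>a\<close> into an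
  \<open>i\<close>-cycle after a point \<open>j\<close>, and \<open>card_orbit_size\<close> counts
  the choices of \<open>j\<close>. The predicate \<open>G\<close> is arbitrary so that the same
  bijection serves for class sizes and for the condition in \<open>B_count\<close>.\<close>

lemma card_of_type_raise:
  assumes Y: "finite Y" "a \<notin> Y" and i: "0 < i" "Suc i \<in># mu"
  shows "card {\<sigma> \<in> of_type (insert a Y) mu. card (orbit \<sigma> a) = Suc i \<and> G (contract a a \<sigma>)} =
    i * count (lower_part mu i) i * card {\<beta> \<in> of_type Y (lower_part mu i). G \<beta>}"
proof -
  let ?lam = "lower_part mu i"
  let ?B = "{\<beta> \<in> of_type Y ?lam. G \<beta>}"
  let ?D = "SIGMA \<beta>:?B. {j \<in> Y. card (orbit \<beta> j) = i}"
  let ?E = "{\<sigma> \<in> of_type (insert a Y) mu. card (orbit \<sigma> a) = Suc i \<and> G (contract a a \<sigma>)}"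
  let ?f = "\<lambda>(\<beta>, j). \<beta> \<circ> transpose a j"
  have contr: "contract a a (\<beta> \<circ> transpose a j) = \<beta>" if "\<beta> permutes Y" "j \<in> Y" for \<beta> j
    using that Y by (intro contract_self_transpose) (auto simp: permutes_inj permutes_not_in)
  have orb: "card (orbit (\<beta> \<circ> transpose a j) a) = Suc (card (orbit \<beta> j))" if "\<beta> permutes Y" "j \<in> Y" for \<beta> j
  proof -
    have "orbit \<beta> j \<subseteq> Y" using permutes_orbit_subset that by metis
    then have "finite (orbit \<beta> j)" "a \<notin> orbit \<beta> j" using Y finite_subset by auto
    then show ?thesis
      using orbit_insert_transpose(1)[OF Y(1) that(1) Y(2) that(2), of a] by simp
  qed
  have "bij_betw ?f ?D ?E"
  proof (rule bij_betw_imageI)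
    show "inj_on ?f ?D"
    proof (rule inj_onI)
      fix p q assume pq: "p \<in> ?D" "q \<in> ?D" "?f p = ?f q"
      obtain \<beta> j \<beta>' j' where d: "p = (\<beta>, j)" "q = (\<beta>', j')" by (metis surj_pair)
      then have e: "\<beta> \<circ> transpose a j = \<beta>' \<circ> transpose a j'" using pq(3) by simp
      have A: "\<beta> permutes Y" "\<beta>' permutes Y" "j \<in> Y" "j' \<in> Y"
        using pq d by (auto simp: of_type_def)
      \<comment> \<open>Deleting \<open>a\<close> recovers \<open>\<beta>\<close>; then the value at
        \<open>a\<close>, which is \<open>\<beta> j\<close>, recovers \<open>j\<close>.\<close>
      have b: "\<beta> = \<beta>'" using contr[OF A(1,3)] contr[OF A(2,4)] e by simp
      then have "\<beta> j = \<beta> j'" using fun_cong[OF e, of a] by simp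
      then show "p = q" using b d permutes_inj[OF A(1)] by (simp add: inj_eq)
    qed
    show "?f ` ?D = ?E"
    proof (intro equalityI subsetI)
      fix \<sigma> assume "\<sigma> \<in> ?f ` ?D"
      then obtain \<beta> j where b: "\<beta> permutes Y" "ctype Y \<beta> = ?lam" "G \<beta>" "j \<in> Y" "card (orbit \<beta> j) = i"
          and s: "\<sigma> = \<beta> \<circ> transpose a j"
        by (auto simp: of_type_def)
      have "\<sigma> permutes insert a Y"
        unfolding s by (intro permutes_compose permutes_swap_id permutes_imp_permutes_insert b) (use b in auto)
      moreover have "ctype (insert a Y) \<sigma> = mu"
        using ctype_insert_transpose(1)[OF Y(1) b(1) Y(2) b(4)] b i s by (simp add: lower_part_def)
      ultimately show "\<sigma> \<in> ?E"
        using contr[OF b(1,4)] orb[OF b(1,4)] b s by (simp add: of_type_def)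
    next
      fix \<sigma> assume E: "\<sigma> \<in> ?E"
      then have "\<sigma> permutes insert a Y" by (simp add: of_type_def)
      then show "\<sigma> \<in> ?f ` ?D"
      proof (cases rule: permutes_insert_cases)
        case fixed
        then have "orbit \<sigma> a = {a}" by (simp add: orbit_eq_singleton_iff)
        then show ?thesis using E i by simp
      next
        case (moved b j)
        have bj: "card (orbit b j) = i" using orb[OF moved(1,2)] E moved(3) by simp
        have "mu = add_mset (Suc i) (ctype Y b - {#i#})" "i \<in># ctype Y b"
          using ctype_insert_transpose[OF Y(1) moved(1) Y(2) moved(2)] bj E moved(3)
          by (auto simp: of_type_def)
        then have "ctype Y b = ?lam" by (simp add: lower_part_def)
        moreover have "G b" using E contr[OF moved(1,2)] moved(3) by simp
        ultimately have "(b, j) \<in> ?D" using moved bj by (simp add: of_type_def)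
        then show ?thesis using moved(3) by (intro image_eqI[of _ _ "(b, j)"]) auto
      qed
    qed
  qed
  then have "card ?E = card ?D" by (simp add: bij_betw_same_card)
  also have "\<dots> = (\<Sum>\<beta>\<in>?B. card {j \<in> Y. card (orbit \<beta> j) = i})"
    by (rule card_SigmaI) (use finite_of_type[OF Y(1)] Y in auto)
  also have "\<dots> = (\<Sum>\<beta>\<in>?B. i * count ?lam i)"
    by (rule sum.cong[OF refl]) (use card_orbit_size[OF Y(1)] in \<open>auto simp: of_type_def\<close>)
  finally show ?thesis by simp
qed

lemma card_of_type_fixed:
  assumes Y: "finite Y" "a \<notin> Y" and "1 \<in># mu"
  shows "card {\<sigma> \<in> of_type (insert a Y) mu. card (orbit \<sigma> a) = 1} = card (of_type Y (mu - {#1#}))"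
proof -
  have "{\<sigma> \<in> of_type (insert a Y) mu. card (orbit \<sigma> a) = 1} = of_type Y (mu - {#1#})"
  proof (intro equalityI subsetI)
    fix \<sigma> assume E: "\<sigma> \<in> {\<sigma> \<in> of_type (insert a Y) mu. card (orbit \<sigma> a) = 1}"
    then have p: "\<sigma> permutes insert a Y" and c: "card (orbit \<sigma> a) = 1" by (simp_all add: of_type_def)
    have "a \<in> orbit \<sigma> a" using self_mem_orbit[OF _ p] Y by simp
    then have "orbit \<sigma> a = {a}" using c by (metis card_1_singletonE singletonD)
    then have "\<sigma> a = a" by (simp add: orbit_eq_singleton_iff)
    then have "\<sigma> permutes Y" using p by (auto intro: permutes_superset)
    then show "\<sigma> \<in> of_type Y (mu - {#1#})"
      using ctype_insert_fixed[OF Y(1) _ Y(2)] E by (auto simp: of_type_def)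
  next
    fix \<sigma> assume E: "\<sigma> \<in> of_type Y (mu - {#1#})"
    then have p: "\<sigma> permutes Y" by (simp add: of_type_def)
    then have "orbit \<sigma> a = {a}" using Y by (simp add: orbit_eq_singleton_iff permutes_not_in)
    then show "\<sigma> \<in> {\<sigma> \<in> of_type (insert a Y) mu. card (orbit \<sigma> a) = 1}"
      using ctype_insert_fixed[OF Y(1) p Y(2)] E permutes_imp_permutes_insert[OF p, of a] assms(3)
      by (auto simp: of_type_def)
  qed
  then show ?thesis by simp
qed

text \<open>Double counting of the pairs of a point \<open>x\<close> and a \<open>\<sigma>\<close>
  having \<open>x\<close> in a cycle of length \<open>k\<close>: by conjugation every point lies in
  as many pairs as \<open>a\<close>, and every \<open>\<sigma>\<close> has
  \<open>k * count mu k\<close> such points.\<close>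

lemma card_of_type_orbit:
  assumes X: "finite X" "a \<in> X"
  shows "card X * card {\<sigma> \<in> of_type X mu. card (orbit \<sigma> a) = k} = k * count mu k * card (of_type X mu)"
proof -
  have fin: "finite (of_type X mu)" using X by (simp add: finite_of_type)
  \<comment> \<open>Cardinalities are written as sums of indicators so that conjugation invariance
    and the exchange of summation apply.\<close>
  have bool: "card {\<sigma> \<in> of_type X mu. P \<sigma>} = (\<Sum>\<sigma>\<in>of_type X mu. of_bool (P \<sigma>))" for P
    using fin by (simp add: Int_def)
  have sym: "card {\<sigma> \<in> of_type X mu. card (orbit \<sigma> x) = k} = card {\<sigma> \<in> of_type X mu. card (orbit \<sigma> a) = k}"
    if x: "x \<in> X" for x
  proof -
    let ?p = "transpose x a"
    have "(\<Sum>\<sigma>\<in>of_type X mu. of_bool (card (orbit \<sigma> a) = k) :: nat) =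
        (\<Sum>\<sigma>\<in>of_type X mu. of_bool (card (orbit (?p \<circ> \<sigma> \<circ> inv ?p) a) = k))"
      by (rule sum_of_type_conj[OF X(1), symmetric]) (use x X in \<open>simp add: permutes_swap_id\<close>)
    also have "\<dots> = (\<Sum>\<sigma>\<in>of_type X mu. of_bool (card (orbit \<sigma> x) = k))"
    proof (rule sum.cong[OF refl])
      fix \<sigma> assume "\<sigma> \<in> of_type X mu"
      then have "\<sigma> permutes X" by (simp add: of_type_def)
      then have "orbit (?p \<circ> \<sigma> \<circ> inv ?p) (?p x) = ?p ` orbit \<sigma> x"
        by (intro orbit_conj[OF X(1)]) simp_all
      then have "card (orbit (?p \<circ> \<sigma> \<circ> inv ?p) a) = card (orbit \<sigma> x)"
        using card_image_bij[of ?p "orbit \<sigma> x"] by simp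
      then show "of_bool (card (orbit (?p \<circ> \<sigma> \<circ> inv ?p) a) = k) = (of_bool (card (orbit \<sigma> x) = k) :: nat)"
        by simp
    qed
    finally show ?thesis unfolding bool by simp
  qed
  have "card X * card {\<sigma> \<in> of_type X mu. card (orbit \<sigma> a) = k} =
      (\<Sum>x\<in>X. card {\<sigma> \<in> of_type X mu. card (orbit \<sigma> x) = k})"
    using sym by simp
  also have "\<dots> = (\<Sum>\<sigma>\<in>of_type X mu. \<Sum>x\<in>X. of_bool (card (orbit \<sigma> x) = k))"
    unfolding bool by (rule sum.swap)
  also have "\<dots> = (\<Sum>\<sigma>\<in>of_type X mu. k * count mu k)"
  proof (rule sum.cong[OF refl])
    fix \<sigma> assume "\<sigma> \<in> of_type X mu"
    then have "card {x \<in> X. card (orbit \<sigma> x) = k} = k * count mu k"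
      using card_orbit_size[OF X(1)] by (auto simp: of_type_def)
    then show "(\<Sum>x\<in>X. of_bool (card (orbit \<sigma> x) = k)) = k * count mu k"
      using X by (simp add: Int_def)
  qed
  finally show ?thesis by simp
qed

lemma zee_add_mset: "zee (add_mset k nu) = zee nu * (k * Suc (count nu k))"
proof -
  let ?S = "insert k (set_mset nu)"
  let ?g = "\<lambda>M i. i ^ count M i * fact (count M i) :: nat"
  \<comment> \<open>If \<open>k\<close> is not a part of \<open>nu\<close>, its factor is
    \<open>k ^ 0 * fact 0 = 1\<close>, so it may be included.\<close>
  have "zee nu = prod (?g nu) ?S"
    unfolding zee_def by (rule prod.mono_neutral_left) (auto simp: not_in_iff)
  also have "\<dots> = ?g nu k * prod (?g nu) (set_mset nu - {k})"
    by (simp add: prod.insert_remove)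
  finally have 1: "zee nu = ?g nu k * prod (?g nu) (set_mset nu - {k})" .
  have "zee (add_mset k nu) = prod (?g (add_mset k nu)) ?S"
    by (simp add: zee_def)
  also have "\<dots> = ?g (add_mset k nu) k * prod (?g (add_mset k nu)) (set_mset nu - {k})"
    by (subst prod.insert_remove) simp_all
  also have "prod (?g (add_mset k nu)) (set_mset nu - {k}) = prod (?g nu) (set_mset nu - {k})"
    by (rule prod.cong) auto
  finally show ?thesis using 1 by (simp add: algebra_simps)
qed

text \<open>Induction by deleting \<open>a\<close> from the permutations in which \<open>a\<close>
  lies in a cycle of length \<open>k\<close>, for some part \<open>k\<close> of \<open>mu\<close>;
  \<open>card_of_type_orbit\<close> says which fraction of the class these are.\<close>

lemma card_of_type:
  assumes "finite X" "0 \<notin># mu" "sum_mset mu = card X"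
  shows "card (of_type X mu) * zee mu = fact (card X)"
  using assms
proof (induction X arbitrary: mu rule: finite_induct)
  case empty
  then have "mu = {#}" by (cases mu) auto
  then show ?case by (simp add: of_type_def ctype_def zee_def)
next
  case (insert a Y)
  let ?X = "insert a Y"
  have n: "card ?X = Suc (card Y)" using insert.hyps by simp
  have "mu \<noteq> {#}" using insert.prems n by auto
  then obtain k nu where mu: "mu = add_mset k nu" using multiset_cases by metis
  have k: "k \<noteq> 0" using insert.prems(1) mu by auto
  have orb: "Suc (card Y) * card {\<sigma> \<in> of_type ?X mu. card (orbit \<sigma> a) = k} = k * Suc (count nu k) * card (of_type ?X mu)"
    using card_of_type_orbit[of ?X a mu k] insert.hyps mu by simp
  have step: "card {\<sigma> \<in> of_type ?X mu. card (orbit \<sigma> a) = k} * zee nu = fact (card Y)"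
  proof (cases "k = 1")
    case True
    have "card (of_type Y nu) * zee nu = fact (card Y)"
      by (rule insert.IH) (use insert.prems n mu True in auto)
    then show ?thesis
      using card_of_type_fixed[OF insert.hyps, of mu] mu True by simp
  next
    case False
    define i where "i = k - 1"
    then have i: "0 < i" "k = Suc i" using k False by auto
    let ?lam = "lower_part mu i"
    have lam: "?lam = add_mset i nu" using mu i by (simp add: lower_part_def)
    have "card (of_type Y ?lam) * zee ?lam = fact (card Y)"
      by (rule insert.IH) (use insert.prems n mu i lam in auto)
    moreover have "Suc i \<in># mu" using mu i by simp
    then have "card {\<sigma> \<in> of_type ?X mu. card (orbit \<sigma> a) = k} = i * count ?lam i * card (of_type Y ?lam)"
      using card_of_type_raise[OF insert.hyps i(1), of mu "\<lambda>_. True"] i(2) by simp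
    \<comment> \<open>The number \<open>i * count ?lam i\<close> of insertion points, multiplied by
      \<open>zee nu\<close>, is exactly \<open>zee ?lam\<close>.\<close>
    ultimately show ?thesis
      unfolding lam by (simp add: zee_add_mset mult_ac)
  qed
  have "card (of_type ?X mu) * zee mu = (k * Suc (count nu k) * card (of_type ?X mu)) * zee nu"
    by (simp add: mu zee_add_mset)
  also have "\<dots> = Suc (card Y) * (card {\<sigma> \<in> of_type ?X mu. card (orbit \<sigma> a) = k} * zee nu)"
    unfolding orb[symmetric] by (simp only: mult.assoc)
  finally show ?case using step n by simp
qed

section \<open>Factorizations of the permutations of a given type\<close>

definition cycles_on :: "'a set \<Rightarrow> ('a \<Rightarrow> 'a) set" where
  "cycles_on X = {c. c permutes X \<and> cyclic_on c X}"

lemma finite_cycles_on: "finite X \<Longrightarrow> finite (cycles_on X)"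
  unfolding cycles_on_def by (rule finite_subset[OF _ finite_permutations[of X]]) auto

lemma card_cycles_on:
  assumes X: "finite X" "X \<noteq> {}"
  shows "card (cycles_on X) = fact (card X - 1)"
proof -
  have "cycles_on X = of_type X {#card X#}"
    using cyclic_on_iff_ctype[OF X] by (auto simp: cycles_on_def of_type_def)
  moreover have "card (of_type X {#card X#}) * zee {#card X#} = fact (card X)"
    by (rule card_of_type) (use X in auto)
  ultimately have "card (cycles_on X) * card X = card X * fact (card X - 1)"
    using X by (simp add: zee_def fact_reduce[of "card X"] card_gt_0_iff)
  then show ?thesis using X by (simp add: card_gt_0_iff)
qed

text \<open>Replacing \<open>c\<close> by \<open>c \<circ> inv \<tau>\<close> exchanges the roles of
  the two cycles. This reconciles the inverse in \<open>B_count\<close> with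
  \<open>bicyclic\<close>.\<close>

lemma card_bicyclic_inv:
  assumes "\<tau> permutes X"
  shows "card (bicyclic X (inv \<tau>)) = card (bicyclic X \<tau>)"
proof (rule bij_betw_same_card)
  have inv: "\<tau> \<circ> inv \<tau> = id" "inv \<tau> \<circ> \<tau> = id" using assms by (simp_all add: permutes_inv_o)
  have 1: "c \<circ> inv \<tau> \<circ> \<tau> = c" "c \<circ> \<tau> \<circ> inv \<tau> = c" for c :: "'a \<Rightarrow> 'a"
    by (simp_all only: comp_assoc inv comp_id)
  show "bij_betw (\<lambda>c. c \<circ> inv \<tau>) (bicyclic X (inv \<tau>)) (bicyclic X \<tau>)"
    by (rule bij_betw_byWitness[where f' = "\<lambda>c. c \<circ> \<tau>"])
      (use assms 1 in \<open>auto simp: bicyclic_def permutes_compose permutes_inv\<close>)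
qed

text \<open>Conjugation by \<open>transpose a x\<close> preserves the type and matches the term for
  \<open>a\<close> with the term for \<open>x\<close>, so all points contribute the same
  total.\<close>

lemma sum_near_pairs:
  assumes X: "finite X" and a: "a \<in> X"
  shows "card X * (\<Sum>\<sigma>\<in>of_type X mu. of_bool (\<sigma> a \<noteq> a) * card (bicyclic (X - {a}) (contract a a \<sigma>))) =
    (\<Sum>\<sigma>\<in>of_type X mu. near_pairs X \<sigma>)"
proof -
  let ?F = "\<lambda>a \<sigma>. of_bool (\<sigma> a \<noteq> a) * card (bicyclic (X - {a}) (contract a a \<sigma>))"
  have sym: "(\<Sum>\<sigma>\<in>of_type X mu. ?F x \<sigma>) = (\<Sum>\<sigma>\<in>of_type X mu. ?F a \<sigma>)" if x: "x \<in> X" for x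
  proof -
    let ?p = "transpose a x"
    have b: "bij ?p" by simp
    have "(\<Sum>\<sigma>\<in>of_type X mu. ?F x \<sigma>) = (\<Sum>\<sigma>\<in>of_type X mu. ?F x (?p \<circ> \<sigma> \<circ> inv ?p))"
      by (rule sum_of_type_conj[OF X, symmetric]) (use x a in \<open>simp add: permutes_swap_id\<close>)
    also have "\<dots> = (\<Sum>\<sigma>\<in>of_type X mu. ?F a \<sigma>)"
    proof (rule sum.cong[OF refl])
      fix \<sigma>
      have "(?p \<circ> \<sigma> \<circ> inv ?p) x \<noteq> x \<longleftrightarrow> \<sigma> a \<noteq> a"
        by (auto simp: transpose_eq_iff)
      moreover have "contract x x (?p \<circ> \<sigma> \<circ> inv ?p) = ?p \<circ> contract a a \<sigma> \<circ> inv ?p"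
        using contract_conj[OF b, of a a \<sigma>] by simp
      moreover have "?p ` (X - {a}) = X - {x}"
        using a x by (simp add: image_set_diff)
      then have "card (bicyclic (X - {x}) (?p \<circ> contract a a \<sigma> \<circ> inv ?p)) =
          card (bicyclic (X - {a}) (contract a a \<sigma>))"
        using card_bicyclic_conj[OF _ b, of "X - {a}" "contract a a \<sigma>"] X by simp
      ultimately show "?F x (?p \<circ> \<sigma> \<circ> inv ?p) = ?F a \<sigma>" by simp
    qed
    finally show ?thesis .
  qed
  have "card X * (\<Sum>\<sigma>\<in>of_type X mu. ?F a \<sigma>) = (\<Sum>x\<in>X. \<Sum>\<sigma>\<in>of_type X mu. ?F x \<sigma>)"
    using sym by simp
  also have "\<dots> = (\<Sum>\<sigma>\<in>of_type X mu. \<Sum>x\<in>X. ?F x \<sigma>)"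
    by (rule sum.swap)
  also have "\<dots> = (\<Sum>\<sigma>\<in>of_type X mu. near_pairs X \<sigma>)"
  proof (rule sum.cong[OF refl])
    fix \<sigma>
    have "(\<Sum>x\<in>X. ?F x \<sigma>) = (\<Sum>x\<in>X. if \<sigma> x \<noteq> x then card (bicyclic (X - {x}) (contract x x \<sigma>)) else 0)"
      by (rule sum.cong) auto
    also have "\<dots> = near_pairs X \<sigma>"
      unfolding near_pairs_def by (rule sum.inter_filter[OF X, symmetric])
    finally show "(\<Sum>x\<in>X. ?F x \<sigma>) = near_pairs X \<sigma>" .
  qed
  finally show ?thesis .
qed

text \<open>The count on the right does not depend on the full cycle \<open>z\<close>, as any two
  are conjugate by a permutation of \<open>Y\<close>. Summing it over all full cycles and exchanging
  the sums gives the left-hand side.\<close>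

lemma sum_bicyclic_of_type:
  assumes Y: "finite Y" "a \<notin> Y" and z: "z \<in> cycles_on Y"
  shows "(\<Sum>\<sigma>\<in>of_type (insert a Y) mu. of_bool (\<sigma> a \<noteq> a) * card (bicyclic Y (contract a a \<sigma>))) =
    card (cycles_on Y) * card {\<sigma> \<in> of_type (insert a Y) mu. \<sigma> a \<noteq> a \<and> cyclic_on (z \<circ> inv (contract a a \<sigma>)) Y}"
proof -
  let ?X = "insert a Y"
  let ?T = "of_type ?X mu"
  let ?P = "\<lambda>z \<sigma>. \<sigma> a \<noteq> a \<and> cyclic_on (z \<circ> inv (contract a a \<sigma>)) Y"
  have fin: "finite ?T" using Y by (simp add: finite_of_type)
  have conP: "contract a a \<sigma> permutes Y" if "\<sigma> \<in> ?T" for \<sigma>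
    using contract_permutes[of \<sigma> ?X a a] that Y by (simp add: of_type_def)
  have bool: "card {\<sigma> \<in> ?T. P \<sigma>} = (\<Sum>\<sigma>\<in>?T. of_bool (P \<sigma>))" for P
    using fin by (simp add: Int_def)
  have sym: "card {\<sigma> \<in> ?T. ?P y \<sigma>} = card {\<sigma> \<in> ?T. ?P z \<sigma>}" if y: "y \<in> cycles_on Y" for y
  proof -
    obtain \<pi> where \<pi>: "\<pi> permutes Y" "y = \<pi> \<circ> z \<circ> inv \<pi>"
      using cyclic_on_conjugate[OF Y(1), of z y] z y by (auto simp: cycles_on_def)
    have b: "bij \<pi>" using \<pi>(1) by (rule permutes_bij)
    \<comment> \<open>Because \<open>\<pi>\<close> fixes \<open>a\<close>, conjugation by it
      preserves whether \<open>a\<close> is moved and commutes with the deletion of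
      \<open>a\<close>.\<close>
    have pa: "\<pi> a = a" "inv \<pi> a = a"
      using \<pi>(1) Y(2) permutes_inv[OF \<pi>(1)] by (simp_all add: permutes_not_in)
    have "card {\<sigma> \<in> ?T. ?P y \<sigma>} = (\<Sum>\<sigma>\<in>?T. of_bool (?P y (\<pi> \<circ> \<sigma> \<circ> inv \<pi>)))"
      unfolding bool
      by (rule sum_of_type_conj[symmetric]) (use Y \<pi> in \<open>auto intro: permutes_imp_permutes_insert\<close>)
    also have "\<dots> = (\<Sum>\<sigma>\<in>?T. of_bool (?P z \<sigma>))"
    proof (rule sum.cong[OF refl])
      fix \<sigma> assume s: "\<sigma> \<in> ?T"
      let ?b = "contract a a \<sigma>" and ?q = "\<lambda>c. \<pi> \<circ> c \<circ> inv \<pi>"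
      have inv: "inv \<pi> (\<pi> x) = x" "\<pi> (inv \<pi> x) = x" "inv ?b (?b x) = x" "?b (inv ?b x) = x" for x
        using \<pi>(1) conP[OF s] by (simp_all add: permutes_inverses)
      have moved: "?q \<sigma> a \<noteq> a \<longleftrightarrow> \<sigma> a \<noteq> a"
        using pa inv by (metis comp_apply)
      have ce: "contract a a (?q \<sigma>) = ?q ?b"
        using contract_conj[OF b, of a a \<sigma>] pa by simp
      have ie: "inv (?q ?b) = ?q (inv ?b)"
        by (rule inv_unique_comp) (simp_all add: fun_eq_iff inv)
      have e: "y \<circ> inv (contract a a (?q \<sigma>)) = ?q (z \<circ> inv ?b)"
        unfolding ce ie \<pi>(2) by (simp add: fun_eq_iff inv)
      have "cyclic_on (?q c) Y \<longleftrightarrow> cyclic_on c Y" for c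
      proof
        show "cyclic_on c Y \<Longrightarrow> cyclic_on (?q c) Y"
          using cyclic_on_conj[OF b, of c Y] permutes_image[OF \<pi>(1)] by simp
        assume "cyclic_on (?q c) Y"
        then have "cyclic_on (inv \<pi> \<circ> ?q c \<circ> inv (inv \<pi>)) (inv \<pi> ` Y)"
          by (rule cyclic_on_conj[OF bij_imp_bij_inv[OF b]])
        moreover have "inv \<pi> \<circ> ?q c \<circ> inv (inv \<pi>) = c"
          using permutes_inv_inv[OF \<pi>(1)] by (simp add: fun_eq_iff inv)
        ultimately show "cyclic_on c Y"
          using permutes_image[OF permutes_inv[OF \<pi>(1)]] by simp
      qed
      then show "of_bool (?P y (?q \<sigma>)) = (of_bool (?P z \<sigma>) :: nat)"
        using moved e by simp
    qed
    finally show ?thesis unfolding bool .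
  qed
  have "card (cycles_on Y) * card {\<sigma> \<in> ?T. ?P z \<sigma>} = (\<Sum>y\<in>cycles_on Y. card {\<sigma> \<in> ?T. ?P y \<sigma>})"
    using sym by simp
  also have "\<dots> = (\<Sum>\<sigma>\<in>?T. \<Sum>y\<in>cycles_on Y. of_bool (?P y \<sigma>))"
    unfolding bool by (rule sum.swap)
  also have "\<dots> = (\<Sum>\<sigma>\<in>?T. of_bool (\<sigma> a \<noteq> a) * card (bicyclic Y (contract a a \<sigma>)))"
  proof (rule sum.cong[OF refl])
    fix \<sigma> assume s: "\<sigma> \<in> ?T"
    have "card (bicyclic Y (contract a a \<sigma>)) = card (bicyclic Y (inv (contract a a \<sigma>)))"
      using card_bicyclic_inv[OF conP[OF s]] by simp
    also have "bicyclic Y (inv (contract a a \<sigma>)) = {y \<in> cycles_on Y. cyclic_on (y \<circ> inv (contract a a \<sigma>)) Y}"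
      by (auto simp: bicyclic_def cycles_on_def)
    finally show "(\<Sum>y\<in>cycles_on Y. of_bool (?P y \<sigma>)) = of_bool (\<sigma> a \<noteq> a) * card (bicyclic Y (contract a a \<sigma>))"
      using finite_cycles_on[OF Y(1)] by (cases "\<sigma> a = a") (simp_all add: Int_def)
  qed
  finally show ?thesis by simp
qed

section \<open>Translation to \<open>A_count\<close> and \<open>B_count\<close>, and the final
  identity\<close>

lemma cycle_type_eq_ctype: "cycle_type n \<sigma> = ctype {1..n} \<sigma>"
  by (simp add: cycle_type_def ctype_def)

lemma A_count_eq: "A_count mu = card (of_type {1..sum_mset mu} mu)"
  by (simp add: A_count_def of_type_def cycle_type_eq_ctype)

lemma B_count_eq:
  assumes "sum_mset lam = N" "1 \<le> N"
  shows "B_count lam = card {\<beta> \<in> of_type {1..N} lam. cyclic_on (long_cycle N \<circ> inv \<beta>) {1..N}}"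
proof -
  have "cyclic_on (long_cycle N \<circ> inv \<beta>) {1..N} \<longleftrightarrow> ctype {1..N} (long_cycle N \<circ> inv \<beta>) = {#N#}"
    if "\<beta> permutes {1..N}" for \<beta>
  proof -
    have "long_cycle N \<circ> inv \<beta> permutes {1..N}"
      using that assms(2) by (intro permutes_compose permutes_inv long_cycle_permutes)
    then show ?thesis using cyclic_on_iff_ctype[of "{1..N}" "long_cycle N \<circ> inv \<beta>"] assms(2) by simp
  qed
  then show ?thesis
    unfolding B_count_def assms(1) of_type_def cycle_type_eq_ctype by (auto intro!: arg_cong[where f = card])
qed

text \<open>Sort the permutations on the right by the length \<open>i + 1\<close> of the cycle
  through \<open>N + 1\<close>; \<open>card_of_type_raise\<close> counts each class, and
  \<open>i > 0\<close> means that \<open>N + 1\<close> is moved.\<close>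

lemma sum_B_count:
  assumes N: "1 \<le> N" and mu: "is_partition (N + 1) mu"
  shows "(\<Sum>i | 0 < i \<and> i + 1 \<in># mu. i * count (lower_part mu i) i * B_count (lower_part mu i)) =
    card {\<sigma> \<in> of_type {1..N + 1} mu. \<sigma> (N + 1) \<noteq> N + 1 \<and>
      cyclic_on (long_cycle N \<circ> inv (contract (N + 1) (N + 1) \<sigma>)) {1..N}}"
proof -
  let ?a = "N + 1" and ?Y = "{1..N}"
  let ?X = "insert ?a ?Y"
  let ?I = "{i. 0 < i \<and> i + 1 \<in># mu}"
  let ?G = "\<lambda>\<beta>. cyclic_on (long_cycle N \<circ> inv \<beta>) ?Y"
  let ?E = "\<lambda>i. {\<sigma> \<in> of_type ?X mu. card (orbit \<sigma> ?a) = Suc i \<and> ?G (contract ?a ?a \<sigma>)}"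
  have X: "{1..N + 1} = ?X" by auto
  have Y: "finite ?Y" "?a \<notin> ?Y" by auto
  have "i \<in> (\<lambda>k. k - 1) ` set_mset mu" if "i \<in> ?I" for i
    using that by (intro image_eqI[of _ _ "i + 1"]) auto
  then have "?I \<subseteq> (\<lambda>k. k - 1) ` set_mset mu" by blast
  then have finI: "finite ?I" by (rule finite_subset) simp
  have "(\<Sum>i\<in>?I. i * count (lower_part mu i) i * B_count (lower_part mu i)) = (\<Sum>i\<in>?I. card (?E i))"
  proof (rule sum.cong[OF refl])
    fix i assume i: "i \<in> ?I"
    then obtain nu where nu: "mu = add_mset (i + 1) nu" by (auto dest: multi_member_split)
    have "sum_mset (lower_part mu i) = N"
      using mu unfolding nu by (simp add: lower_part_def is_partition_def)
    then show "i * count (lower_part mu i) i * B_count (lower_part mu i) = card (?E i)"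
      using card_of_type_raise[OF Y, of i mu ?G] i by (simp add: B_count_eq[OF _ N])
  qed
  also have "\<dots> = card (\<Union>i\<in>?I. ?E i)"
    by (rule card_UN_disjoint[symmetric]) (use finI finite_of_type[of ?X mu] in auto)
  also have "(\<Union>i\<in>?I. ?E i) = {\<sigma> \<in> of_type ?X mu. \<sigma> ?a \<noteq> ?a \<and> ?G (contract ?a ?a \<sigma>)}"
  proof -
    \<comment> \<open>The length of the cycle through \<open>?a\<close> is always a part of
      \<open>mu\<close>, so the only restriction left is that it is not \<open>1\<close>.\<close>
    have "(\<exists>i\<in>?I. card (orbit \<sigma> ?a) = Suc i) \<longleftrightarrow> \<sigma> ?a \<noteq> ?a" if s: "\<sigma> \<in> of_type ?X mu" for \<sigma>
    proof -
      have p: "\<sigma> permutes ?X" and c: "ctype ?X \<sigma> = mu" using s by (auto simp: of_type_def)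
      have self: "?a \<in> orbit \<sigma> ?a" using self_mem_orbit[OF _ p] by simp
      have "orbit \<sigma> ?a \<subseteq> ?X" by (rule permutes_orbit_subset[OF p]) simp
      then have "finite (orbit \<sigma> ?a)" by (rule finite_subset) simp
      then have pos: "0 < card (orbit \<sigma> ?a)" using self by (auto simp: card_gt_0_iff)
      have one: "card (orbit \<sigma> ?a) = 1 \<longleftrightarrow> \<sigma> ?a = ?a"
        using self orbit_eq_singleton_iff[of \<sigma> ?a] by (metis card_1_singletonE is_singletonI is_singleton_altdef singletonD)
      have "card (orbit \<sigma> ?a) \<in># ctype ?X \<sigma>" unfolding ctype_def by simp
      then have "card (orbit \<sigma> ?a) \<in># mu" using c by simp
      then show ?thesis using pos one by (cases "card (orbit \<sigma> ?a)") auto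
    qed
    then show ?thesis by blast
  qed
  finally show ?thesis unfolding X .
qed

theorem theorem1p2:
  fixes N p :: nat and mu :: "nat multiset"
  assumes "N \<ge> 1"
    and "is_partition (N + 1) mu"
    and "size mu = p"
    and "p mod 2 = N mod 2"
  shows "(real (N + 1) / 2) *
           (\<Sum>i\<in>{i. 0 < i \<and> i + 1 \<in># mu}.
              real i * real (count (lower_part mu i) i) * real (B_count (lower_part mu i)))
           = real (A_count mu)
       \<and> real (A_count mu) = real (fact (N + 1)) / real (zee mu)"
proof -
  let ?a = "N + 1" and ?Y = "{1..N}"
  let ?X = "insert ?a ?Y"
  let ?S = "\<Sum>i | 0 < i \<and> i + 1 \<in># mu. i * count (lower_part mu i) i * B_count (lower_part mu i)"
  have X: "{1..N + 1} = ?X" by auto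
  have X': "finite ?X" "card ?X = N + 1" and XY: "?X - {?a} = ?Y" by auto
  have mu: "0 \<notin># mu" "sum_mset mu = N + 1" using assms(2) by (auto simp: is_partition_def)
  have A: "A_count mu = card (of_type ?X mu)" unfolding A_count_eq mu X ..
  have Az: "A_count mu * zee mu = fact (N + 1)"
    using card_of_type[OF X'(1) mu(1)] mu(2) X'(2) A by simp
  have z: "long_cycle N \<in> cycles_on ?Y"
    using long_cycle_permutes long_cycle_cyclic assms(1) by (simp add: cycles_on_def)
  let ?H = "\<Sum>\<sigma>\<in>of_type ?X mu. of_bool (\<sigma> ?a \<noteq> ?a) * card (bicyclic ?Y (contract ?a ?a \<sigma>))"
  \<comment> \<open>The factor is the number of full cycles on \<open>?Y\<close>, over which the
    fixed \<open>long_cycle N\<close> is averaged.\<close>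
  have H: "?H = fact (N - 1) * ?S"
    using sum_bicyclic_of_type[OF _ _ z, of ?a mu] sum_B_count[OF assms(1,2)] card_cycles_on[of ?Y] assms(1)
    unfolding X by simp
  have "(N + 1) * ?H = (\<Sum>\<sigma>\<in>of_type ?X mu. near_pairs ?X \<sigma>)"
    using sum_near_pairs[OF X'(1), of ?a mu] unfolding X'(2) XY by simp
  also have "\<dots> = (\<Sum>\<sigma>\<in>of_type ?X mu. 2 * fact (N - 1))"
  proof (rule sum.cong[OF refl])
    fix \<sigma> assume s: "\<sigma> \<in> of_type ?X mu"
    then have p: "\<sigma> permutes ?X" and c: "ctype ?X \<sigma> = mu" by (auto simp: of_type_def)
    \<comment> \<open>There are \<open>N + 1\<close> points and \<open>p\<close> cycles with
      \<open>p\<close> of the parity of \<open>N\<close>, so \<open>\<sigma>\<close> is odd.\<close>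
    have "odd (N + 1 + p)" using assms(4) by presburger
    then have "\<not> evenperm \<sigma>"
      using evenperm_iff_ctype[OF X'(1) p] c X'(2) assms(3) by simp
    then show "near_pairs ?X \<sigma> = 2 * fact (N - 1)"
      using near_pairs_odd[OF X'(1) p] X'(2) by simp
  qed
  also have "\<dots> = A_count mu * (2 * fact (N - 1))" using A by simp
  finally have "fact (N - 1) * ((N + 1) * ?S) = fact (N - 1) * (2 * A_count mu)"
    unfolding H by (simp only: ac_simps)
  \<comment> \<open>The common factor \<open>fact (N - 1)\<close> comes from the averaging on the
    left and from \<open>card ?X - 2 = N - 1\<close> on the right.\<close>
  then have key: "(N + 1) * ?S = 2 * A_count mu" by simp
  have "real (N + 1) * real ?S = 2 * real (A_count mu)"
    using arg_cong[OF key, of real] by (simp only: of_nat_mult of_nat_numeral)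
  then have "real (N + 1) / 2 * real ?S = real (A_count mu)"
    by (simp only: times_divide_eq_left)
  have "zee mu \<noteq> 0" using Az by (metis fact_nonzero mult_0_right)
  with arg_cong[OF Az, of real] have "real (A_count mu) = real (fact (N + 1)) / real (zee mu)"
    by (simp only: of_nat_mult) (simp add: field_simps)
  with \<open>real (N + 1) / 2 * real ?S = real (A_count mu)\<close> show ?thesis
    by (simp only: of_nat_sum of_nat_mult)
qed

end
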